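(* Let $0<a<1$ and $0\le b<1$, and let $\mu$ be the probability measure on $[0,1]$ associated with $f_\pm$ defined in the context. Let $(x_i)_{i\ge0}$ be an arbitrary orbit of $f_\pm$. Then the empirical measure $\frac1n\sum_{i=0}^{n-1}\delta_{x_i}$ converges weakly to $\mu$ as $n\to\infty$.
   Context: For real $x$ let $\{x\}:=x-\lfloor x\rfloor\in[0,1)$ and $\{x\}_+:=1-\{-x\}\in(0,1]$. For constants $0<a<1$, $0\le b<1$ define $f_-,f_+:[0,1]\to[0,1]$ by $f_-(x)=\{ax+b\}$, $f_+(x)=\{ax+b\}_+$, and let $f_\pm$ be the multi-valued map $x\mapsto\{f_-(x),f_+(x)\}$. An orbit of $f_\pm$ is any sequence $(x_n)_{n\ge0}$ in $[0,1]$ with $x_{n+1}\in f_\pm(x_n)$ for all $n\ge0$; it is periodic if $x_{n+q}=x_n$ for some $q\ge1$ and all $n\ge0$. Rotation number: let $F_-(x):=ax+b+(1-a)\lfloor x\rfloor$ and $F_+(x):=ax+b-(1-a)\lfloor 1-x\rfloor$ for $x\in\mathbb R$. The rotation number $\rho\in[0,1)$ of $f_\pm$ is the number such that $F_-^n(x)/n\to\rho$ and $F_+^n(x)/n\to\rho$ as $n\to\infty$ for every $x\in\mathbb R$ (the limits exist, coincide and do not depend on $x$). The measure $\mu$: if $\rho$ is rational, then $f_\pm$ has a periodic orbit, whose set of points $C$ is unique, and $\mu$ is the uniform probability measure on the finite set $C$ (mass $1/|C|$ at each point). If $\rho$ is irrational, $\mu$ is the image of Lebesgue measure on $[0,1]$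 under the map $$\phi_\rho(x):=\frac{b}{1-a}+(1-a)\sum_{j=0}^\infty a^j\lfloor x-(j+1)\rho\rfloor ,$$ which maps $[0,1]$ into $[0,1]$ in this case. *)

theory Defs
  imports "HOL-Probability.Probability"
begin

text \<open>The library function \<^term>\<open>frac\<close> takes values in \<open>[0,1)\<close>; this variant
  takes values in \<open>(0,1]\<close>.\<close>
definition frac_plus :: "real \<Rightarrow> real" where
  "frac_plus x = 1 - frac (- x)"

definition f_minus :: "real \<Rightarrow> real \<Rightarrow> real \<Rightarrow> real" where
  "f_minus a b x = frac (a * x + b)"

definition f_plus :: "real \<Rightarrow> real \<Rightarrow> real \<Rightarrow> real" where
  "f_plus a b x = frac_plus (a * x + b)"

definition f_pm :: "real \<Rightarrow> real \<Rightarrow> real \<Rightarrow> real set" where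
  "f_pm a b x = {f_minus a b x, f_plus a b x}"

definition is_orbit :: "real \<Rightarrow> real \<Rightarrow> (nat \<Rightarrow> real) \<Rightarrow> bool" where
  "is_orbit a b x \<longleftrightarrow> (\<forall>n. x n \<in> {0..1}) \<and> (\<forall>n. x (Suc n) \<in> f_pm a b (x n))"

definition is_periodic_orbit :: "real \<Rightarrow> real \<Rightarrow> (nat \<Rightarrow> real) \<Rightarrow> bool" where
  "is_periodic_orbit a b x \<longleftrightarrow> is_orbit a b x \<and> (\<exists>q\<ge>1. \<forall>n. x (n + q) = x n)"

definition F_minus :: "real \<Rightarrow> real \<Rightarrow> real \<Rightarrow> real" where
  "F_minus a b x = a * x + b + (1 - a) * of_int \<lfloor>x\<rfloor>"

definition F_plus :: "real \<Rightarrow> real \<Rightarrow> real \<Rightarrow> real" where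
  "F_plus a b x = a * x + b - (1 - a) * of_int \<lfloor>1 - x\<rfloor>"

definition is_rotation_number :: "real \<Rightarrow> real \<Rightarrow> real \<Rightarrow> bool" where
  "is_rotation_number a b \<rho> \<longleftrightarrow> \<rho> \<in> {0..<1} \<and>
     (\<forall>x. (\<lambda>n. (F_minus a b ^^ n) x / real n) \<longlonglongrightarrow> \<rho> \<and>
          (\<lambda>n. (F_plus a b ^^ n) x / real n) \<longlonglongrightarrow> \<rho>)"

definition rotation_number :: "real \<Rightarrow> real \<Rightarrow> real" where
  "rotation_number a b = (THE \<rho>. is_rotation_number a b \<rho>)"

text \<open>Only meaningful for a rational rotation number, where all periodic orbits have
  the same set of points.\<close>
definition periodic_set :: "real \<Rightarrow> real \<Rightarrow> real set" where
  "periodic_set a b = (THE C. \<exists>x. is_periodic_orbit a b x \<and> C = range x)"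

definition phi :: "real \<Rightarrow> real \<Rightarrow> real \<Rightarrow> real \<Rightarrow> real" where
  "phi a b \<rho> x =
     b / (1 - a) + (1 - a) * (\<Sum>j. a ^ j * of_int \<lfloor>x - (real j + 1) * \<rho>\<rfloor>)"

text \<open>Measures on \<open>[0,1]\<close> are represented as Borel measures on the real line
  concentrated on \<open>[0,1]\<close>; since \<open>[0,1]\<close> is closed, weak convergence is the same
  in both settings. In the rational case, taking the image under the identity only changes
  the underlying space from the periodic set to the real line.\<close>
definition mu :: "real \<Rightarrow> real \<Rightarrow> real measure" where
  "mu a b =
     (let \<rho> = rotation_number a b in
      if \<rho> \<in> \<rat> then distr (uniform_count_measure (periodic_set a b)) borel (\<lambda>x. x)
      else distr (restrict_space lborel {0..1}) borel (phi a b \<rho>))"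

text \<open>The image of the uniform measure on \<open>{0,\<dots>,n-1}\<close> under \<open>x\<close>, i.e. the mean of the
  Dirac measures at \<open>x\<^sub>0,\<dots>,x\<^sub>n\<^sub>-\<^sub>1\<close>, see the lemma below.\<close>
definition empirical_measure :: "(nat \<Rightarrow> real) \<Rightarrow> nat \<Rightarrow> real measure" where
  "empirical_measure x n = distr (uniform_count_measure {..<n}) borel x"

lemma emeasure_empirical_measure:
  assumes "n > 0" and "A \<in> sets borel"
  shows "emeasure (empirical_measure x n) A =
           ennreal ((1 / real n) * (\<Sum>i<n. measure (return borel (x i)) A))"
proof -
  have m: "x \<in> measurable (uniform_count_measure {..<n}) borel"
    by (simp add: measurable_def sets_uniform_count_measure space_uniform_count_measure)
  have "emeasure (empirical_measure x n) A = emeasure (uniform_count_measure {..<n}) (x -` A \<inter> {..<n})"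
    unfolding empirical_measure_def
    using assms(2) m by (simp add: emeasure_distr space_uniform_count_measure)
  also have "\<dots> = ennreal (card (x -` A \<inter> {..<n}) / card {..<n})"
    by (rule emeasure_uniform_count_measure) auto
  also have "real (card (x -` A \<inter> {..<n})) = (\<Sum>i<n. indicator A (x i))"
    by (simp add: indicator_def sum.If_cases vimage_def Int_commute)
  also have "\<dots> = (\<Sum>i<n. measure (return borel (x i)) A)"
    using assms(2) by (simp add: measure_return)
  finally show ?thesis by simp
qed

end

theory Submission
  imports Defs
begin

text \<open>An orbit lifts to a pair \<open>(X, K)\<close> with integers \<open>K n \<le> X n \<le> K n + 1\<close> and
  \<open>X (n + 1) = a X n + b + (1 - a) K n\<close>. Comparing it with the iterates of the extremal lifts
  \<open>F_plus\<close> and \<open>F_minus\<close> shows that \<open>K n - n \<rho>\<close> oscillates by at most \<open>1\<close>, so that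
  \<open>K n = \<lfloor>n \<rho> + \<theta>\<rfloor>\<close> for some phase \<open>\<theta>\<close> and all large \<open>n\<close>. The function \<open>\<phi>\<^sub>\<rho>\<close> satisfies the
  same recursion along \<open>y \<mapsto> y + \<rho>\<close>, hence by contraction \<open>x n\<close> is asymptotic to
  \<open>\<phi>\<^sub>\<rho> {n \<rho> + \<theta>}\<close>. Since \<open>\<phi>\<^sub>\<rho>\<close> is monotone, the frequency of \<open>x n \<le> t\<close> is the frequency with which the
  rotation visits an initial interval. For interval lengths in \<open>\<int> \<rho> + \<int>\<close> the count of visits
  telescopes; this covers the multiples of \<open>1/q\<close> if \<open>\<rho> = p/q\<close>, and a dense set of lengths if
  \<open>\<rho>\<close> is irrational.\<close>

subsection \<open>Rotation numbers and lifted orbits\<close>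

lemma degree_one_funpow_add_int:
  fixes F :: "real \<Rightarrow> real"
  assumes "\<And>x (k::int). F (x + k) = F x + k"
  shows "(F ^^ n) (x + of_int k) = (F ^^ n) x + of_int k"
  by (induction n arbitrary: x) (auto simp: assms simp del: funpow.simps simp: funpow_Suc_right)

text \<open>Monotonicity traps \<open>(F ^^ n) x\<close> between the images of
  \<open>\<lfloor>x\<rfloor>\<close> and \<open>\<lfloor>x\<rfloor> + 1\<close>, and
  \<open>F ^^ n\<close> commutes with integer translations.\<close>

lemma degree_one_displacement:
  fixes F :: "real \<Rightarrow> real"
  assumes "mono F" and "\<And>x (k::int). F (x + k) = F x + k"
  shows "\<bar>(F ^^ n) x - x - (F ^^ n) 0\<bar> \<le> 1"
proof -
  have m: "mono (F ^^ n)"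
    using assms(1) by (rule mono_pow)
  have "(F ^^ n) (0 + of_int \<lfloor>x\<rfloor>) \<le> (F ^^ n) x"
    by (rule monoD[OF m]) simp
  moreover have "(F ^^ n) x \<le> (F ^^ n) (0 + of_int (\<lfloor>x\<rfloor> + 1))"
    by (rule monoD[OF m]) linarith
  ultimately have "(F ^^ n) 0 + of_int \<lfloor>x\<rfloor> \<le> (F ^^ n) x" "(F ^^ n) x \<le> (F ^^ n) 0 + of_int \<lfloor>x\<rfloor> + 1"
    using degree_one_funpow_add_int[OF assms(2), of n 0 "\<lfloor>x\<rfloor>"]
      degree_one_funpow_add_int[OF assms(2), of n 0 "\<lfloor>x\<rfloor> + 1"] by simp_all
  then show ?thesis by linarith
qed

text \<open>Poincare's argument: the orbit of 0 is additive in time up to an error of 1, so its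
  averages are Cauchy; another starting point changes the iterates only by a bounded amount.\<close>

lemma degree_one_rotation_number:
  fixes F :: "real \<Rightarrow> real"
  assumes "mono F" and "\<And>x (k::int). F (x + k) = F x + k"
  shows "\<exists>\<rho>. \<forall>x. (\<lambda>n. (F ^^ n) x / real n) \<longlonglongrightarrow> \<rho>"
proof -
  define u where "u n = (F ^^ n) 0" for n
  have step: "\<bar>u (m + n) - u n - u m\<bar> \<le> 1" for m n
    using degree_one_displacement[OF assms, of m "u n"] by (simp add: u_def funpow_add)
  have mult: "\<bar>u (k * n) - real k * u n\<bar> \<le> real k" for k n
  proof (induction k)
    case 0
    then show ?case by (simp add: u_def)
  next
    case (Suc k)
    have "u (Suc k * n) - real (Suc k) * u n
        = (u (n + k * n) - u (k * n) - u n) + (u (k * n) - real k * u n)"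
      by (simp add: algebra_simps)
    with Suc step[of n "k * n"] show ?case by simp
  qed
  \<comment> \<open>Both \<open>m * u n\<close> and \<open>n * u m\<close> are compared with
    \<open>u (m * n)\<close>.\<close>
  have close: "\<bar>u n / real n - u m / real m\<bar> \<le> 1 / real n + 1 / real m"
    if "n > 0" "m > 0" for m n
  proof -
    have "\<bar>real m * u n - real n * u m\<bar> \<le> real m + real n"
      using mult[of m n] mult[of n m] unfolding mult.commute[of n m] by linarith
    then have "\<bar>real m * u n - real n * u m\<bar> / (real m * real n) \<le> (real m + real n) / (real m * real n)"
      by (rule divide_right_mono) simp
    moreover have "\<bar>real m * u n - real n * u m\<bar> / (real m * real n) = \<bar>u n / real n - u m / real m\<bar>"
    proof -
      have "u n / real n - u m / real m = (real m * u n - real n * u m) / (real m * real n)"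
        using that by (simp add: field_simps)
      then show ?thesis by (simp add: abs_mult)
    qed
    moreover have "(real m + real n) / (real m * real n) = 1 / real n + 1 / real m"
      using that by (simp add: add_divide_distrib)
    ultimately show ?thesis by linarith
  qed
  have "Cauchy (\<lambda>n. u n / real n)"
  proof (rule metric_CauchyI)
    fix e :: real assume "e > 0"
    obtain M :: nat where M: "M > 0" "1 / real M < e / 2"
      using \<open>e > 0\<close> by (metis half_gt_zero real_arch_inverse inverse_eq_divide gr0I)
    have "dist (u m / real m) (u n / real n) < e" if "m \<ge> M" "n \<ge> M" for m n
    proof -
      have "1 / real m \<le> 1 / real M" "1 / real n \<le> 1 / real M"
        using that M by (auto simp: field_simps)
      moreover have "\<bar>u m / real m - u n / real n\<bar> \<le> 1 / real m + 1 / real n"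
        using that M by (intro close) auto
      ultimately show ?thesis using M by (simp add: dist_real_def)
    qed
    then show "\<exists>M. \<forall>m\<ge>M. \<forall>n\<ge>M. dist (u m / real m) (u n / real n) < e" by blast
  qed
  then obtain \<rho> where \<rho>: "(\<lambda>n. u n / real n) \<longlonglongrightarrow> \<rho>"
    using Cauchy_convergent convergentD by blast
  have "(\<lambda>n. (F ^^ n) x / real n) \<longlonglongrightarrow> \<rho>" for x
  proof -
    have "(\<lambda>n. ((F ^^ n) x - u n) / real n) \<longlonglongrightarrow> 0"
    proof (rule Lim_null_comparison)
      have "\<bar>(F ^^ n) x - u n\<bar> \<le> \<bar>x\<bar> + 1" for n
        using degree_one_displacement[OF assms, of n x] unfolding u_def by linarith
      then show "\<forall>\<^sub>F n in sequentially. norm (((F ^^ n) x - u n) / real n) \<le> (\<bar>x\<bar> + 1) / real n"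
        by (intro always_eventually) (auto intro!: divide_right_mono simp: abs_divide)
      show "(\<lambda>n. (\<bar>x\<bar> + 1) / real n) \<longlonglongrightarrow> 0"
        by (rule lim_const_over_n)
    qed
    from tendsto_add[OF \<rho> this] show ?thesis by (simp add: diff_divide_distrib)
  qed
  then show ?thesis by blast
qed

section \<open>Contracted rotations: extremal lifts and comparison of lift orbits\<close>

locale contracted_rotation =
  fixes a b :: real
  assumes a_pos: "0 < a" and a_less: "a < 1" and b_nonneg: "0 \<le> b" and b_less: "b < 1"
begin

lemma F_minus_add_int: "F_minus a b (x + of_int k) = F_minus a b x + of_int k"
  by (simp add: F_minus_def algebra_simps)

lemma F_plus_add_int: "F_plus a b (x + of_int k) = F_plus a b x + of_int k"
proof -
  have "1 - (x + of_int k) = (1 - x) - of_int k" by simp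
  then have "\<lfloor>1 - (x + of_int k)\<rfloor> = \<lfloor>1 - x\<rfloor> - k"
    by (simp only: floor_diff_of_int)
  then have e: "real_of_int \<lfloor>1 - (x + of_int k)\<rfloor> = real_of_int \<lfloor>1 - x\<rfloor> - real_of_int k"
    by (simp only: of_int_diff)
  show ?thesis by (simp only: F_plus_def e) (simp add: algebra_simps)
qed

lemma mono_F_minus: "mono (F_minus a b)"
  unfolding F_minus_def using a_pos a_less
  by (intro monoI add_mono mult_left_mono) (auto intro: floor_mono)

lemma mono_F_plus: "mono (F_plus a b)"
  unfolding F_plus_def using a_pos a_less
  by (intro monoI diff_mono add_mono mult_left_mono) (auto intro: floor_mono)

text \<open>An orbit of the multivalued degree-one lift of \<open>f_pm\<close>; at an integer \<open>X n\<close> both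
  \<open>K n = X n\<close> and \<open>K n = X n - 1\<close> are allowed.\<close>
definition lift_orbit :: "(nat \<Rightarrow> real) \<Rightarrow> (nat \<Rightarrow> int) \<Rightarrow> bool" where
  "lift_orbit X K \<longleftrightarrow> (\<forall>n. of_int (K n) \<le> X n \<and> X n \<le> of_int (K n) + 1 \<and>
      X (Suc n) = a * X n + b + (1 - a) * of_int (K n))"

lemma lift_orbitD:
  assumes "lift_orbit X K"
  shows "of_int (K n) \<le> X n" "X n \<le> of_int (K n) + 1"
    "X (Suc n) = a * X n + b + (1 - a) * of_int (K n)"
  using assms unfolding lift_orbit_def by auto

lemma lift_orbit_shift:
  assumes "lift_orbit X K"
  shows "lift_orbit (\<lambda>n. X (n + d) + of_int p) (\<lambda>n. K (n + d) + p)"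
  using assms unfolding lift_orbit_def by (auto simp: algebra_simps)

lemma F_minus_lift_orbit: "lift_orbit (\<lambda>n. (F_minus a b ^^ n) x) (\<lambda>n. \<lfloor>(F_minus a b ^^ n) x\<rfloor>)"
  unfolding lift_orbit_def by (auto simp: F_minus_def)

lemma lift_orbit_less_imp_le:
  assumes "lift_orbit X K" "lift_orbit Y L" "X n < Y n"
  shows "K n \<le> L n"
  using lift_orbitD[OF assms(1), of n] lift_orbitD[OF assms(2), of n] assms(3) by linarith

lemma lift_orbit_less_Suc:
  assumes "lift_orbit X K" "lift_orbit Y L" "X n < Y n"
  shows "X (Suc n) < Y (Suc n)"
proof -
  have "a * X n < a * Y n" using a_pos assms(3) by simp
  moreover have "(1 - a) * real_of_int (K n) \<le> (1 - a) * real_of_int (L n)"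
    using lift_orbit_less_imp_le[OF assms] a_less by (intro mult_left_mono) auto
  ultimately show ?thesis
    using lift_orbitD(3)[OF assms(1), of n] lift_orbitD(3)[OF assms(2), of n] by linarith
qed

lemma lift_orbit_less:
  assumes "lift_orbit X K" "lift_orbit Y L" "X n < Y n" "n \<le> m"
  shows "X m < Y m"
  using assms(4,3) by (induction rule: dec_induct) (auto intro: lift_orbit_less_Suc[OF assms(1,2)])

text \<open>Since \<open>1 - a\<close> is nonzero, two consecutive values reveal which branch was
  taken at an integer.\<close>

lemma lift_orbit_K_determined:
  assumes "lift_orbit X K" "lift_orbit Y L" "X n = Y n" "X (Suc n) = Y (Suc n)"
  shows "K n = L n"
proof -
  have "(1 - a) * real_of_int (K n) = (1 - a) * real_of_int (L n)"
    using lift_orbitD(3)[OF assms(1), of n] lift_orbitD(3)[OF assms(2), of n] assms(4)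
    unfolding assms(3) by linarith
  then show ?thesis using a_less by simp
qed

text \<open>\<open>\<lfloor>X n\<rfloor>\<close> is the largest integer allowed for
  \<open>K n\<close>, so \<open>F_minus\<close> is the upper branch of the lift in spite of its
  name; monotonicity carries the bound through the iterates.\<close>

lemma lift_orbit_le_F_minus:
  assumes "lift_orbit X K"
  shows "X (n + d) \<le> (F_minus a b ^^ d) (X n)"
proof (induction d)
  case (Suc d)
  have "X (n + Suc d) \<le> F_minus a b (X (n + d))"
    using lift_orbitD[OF assms, of "n + d"] a_less
    by (auto simp: F_minus_def intro!: mult_left_mono) linarith
  also have "\<dots> \<le> F_minus a b ((F_minus a b ^^ d) (X n))"
    by (rule monoD[OF mono_F_minus Suc])
  finally show ?case by simp
qed auto

text \<open>\<open>- \<lfloor>1 - X n\<rfloor>\<close> equals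
  \<open>\<lceil>X n\<rceil> - 1\<close>, the smallest integer allowed for \<open>K n\<close>, so
  \<open>F_plus\<close> is the lower branch.\<close>

lemma F_plus_le_lift_orbit:
  assumes "lift_orbit X K"
  shows "(F_plus a b ^^ d) (X n) \<le> X (n + d)"
proof (induction d)
  case (Suc d)
  have "F_plus a b ((F_plus a b ^^ d) (X n)) \<le> F_plus a b (X (n + d))"
    by (rule monoD[OF mono_F_plus Suc])
  also have "\<dots> \<le> X (n + Suc d)"
  proof -
    have "- \<lfloor>1 - X (n + d)\<rfloor> \<le> K (n + d)"
      using lift_orbitD[OF assms, of "n + d"] by linarith
    then have "real_of_int (- \<lfloor>1 - X (n + d)\<rfloor>) \<le> real_of_int (K (n + d))"
      by (simp only: of_int_le_iff)
    then have "(1 - a) * real_of_int (- \<lfloor>1 - X (n + d)\<rfloor>) \<le> (1 - a) * real_of_int (K (n + d))"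
      using a_less by (intro mult_left_mono) auto
    then show ?thesis
      using lift_orbitD(3)[OF assms, of "n + d"] by (simp add: F_plus_def)
  qed
  finally show ?case by simp
qed auto

text \<open>A strictly larger argument outweighs the choice of branch: the upper integer choice at
  \<open>x\<close> is at most the lower one at \<open>y\<close>.\<close>

lemma F_minus_less_F_plus:
  assumes "x < y"
  shows "F_minus a b x < F_plus a b y"
proof -
  have "\<lfloor>x\<rfloor> \<le> - \<lfloor>1 - y\<rfloor>" using assms by linarith
  then have "real_of_int \<lfloor>x\<rfloor> \<le> real_of_int (- \<lfloor>1 - y\<rfloor>)"
    by (simp only: of_int_le_iff)
  then have "(1 - a) * real_of_int \<lfloor>x\<rfloor> \<le> (1 - a) * real_of_int (- \<lfloor>1 - y\<rfloor>)"
    using a_less by (intro mult_left_mono) auto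
  moreover have "a * x < a * y" using assms a_pos by simp
  ultimately show ?thesis by (simp add: F_minus_def F_plus_def)
qed

lemma F_plus_le_F_minus: "(F_plus a b ^^ n) x \<le> (F_minus a b ^^ n) x"
  using F_plus_le_lift_orbit[OF F_minus_lift_orbit[of x], of n 0] by simp

text \<open>The comparison is iterated from \<open>x\<close> and \<open>x + 1\<close>. With
  \<open>F_plus_le_F_minus\<close> it keeps the two extremal orbits within distance 1, so both have
  the same rotation number.\<close>

lemma F_minus_funpow_less_F_plus: "(F_minus a b ^^ n) x < (F_plus a b ^^ n) x + 1"
proof -
  have "(F_minus a b ^^ n) x < (F_plus a b ^^ n) (x + of_int 1)"
    by (induction n) (auto intro: F_minus_less_F_plus)
  then show ?thesis
    using degree_one_funpow_add_int[OF F_plus_add_int, of n x 1] by simp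
qed

lemma rotation_number_exists: "\<exists>\<rho>. is_rotation_number a b \<rho>"
proof -
  obtain \<rho> where \<rho>: "\<And>x. (\<lambda>n. (F_minus a b ^^ n) x / real n) \<longlonglongrightarrow> \<rho>"
    using degree_one_rotation_number[OF mono_F_minus F_minus_add_int] by blast
  have plus: "(\<lambda>n. (F_plus a b ^^ n) x / real n) \<longlonglongrightarrow> \<rho>" for x
  proof (rule tendsto_sandwich)
    show "(\<lambda>n. (F_minus a b ^^ n) x / real n - 1 / real n) \<longlonglongrightarrow> \<rho>"
      using tendsto_diff[OF \<rho>[of x] lim_const_over_n[of 1]] by simp
    show "(\<lambda>n. (F_minus a b ^^ n) x / real n) \<longlonglongrightarrow> \<rho>" by (rule \<rho>)
    show "\<forall>\<^sub>F n in sequentially.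
        (F_minus a b ^^ n) x / real n - 1 / real n \<le> (F_plus a b ^^ n) x / real n"
      using less_imp_le[OF F_minus_funpow_less_F_plus[of _ x]]
      by (intro always_eventually)
         (auto simp: diff_divide_distrib[symmetric] intro!: divide_right_mono simp: diff_le_eq)
    show "\<forall>\<^sub>F n in sequentially. (F_plus a b ^^ n) x / real n \<le> (F_minus a b ^^ n) x / real n"
      using F_plus_le_F_minus by (intro always_eventually allI divide_right_mono) auto
  qed
  \<comment> \<open>To place \<open>\<rho>\<close> in \<open>{0..<1}\<close>: the upper orbit of 0
    stays nonnegative and, because \<open>\<lfloor>y\<rfloor> \<le> y\<close>, gains at most
    \<open>b < 1\<close> per step.\<close>
  let ?u = "\<lambda>n. (F_minus a b ^^ n) 0"
  have ge: "0 \<le> ?u n" for n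
  proof (induction n)
    case (Suc n)
    have "0 \<le> F_minus a b 0" using b_nonneg by (simp add: F_minus_def)
    also have "\<dots> \<le> F_minus a b (?u n)" using mono_F_minus Suc by (rule monoD)
    finally show ?case by simp
  qed auto
  have le: "?u n \<le> real n * b" for n
  proof (induction n)
    case (Suc n)
    have "(1 - a) * real_of_int \<lfloor>?u n\<rfloor> \<le> (1 - a) * ?u n"
      using a_less by (intro mult_left_mono) auto
    then have "?u (Suc n) \<le> ?u n + b"
      by (simp add: F_minus_def algebra_simps)
    with Suc show ?case by (simp add: algebra_simps)
  qed auto
  have "0 \<le> \<rho>"
    by (rule LIMSEQ_le_const[OF \<rho>[of 0]]) (auto intro!: exI[of _ 0] divide_nonneg_nonneg ge)
  moreover have "\<rho> \<le> b"
  proof (rule LIMSEQ_le_const2[OF \<rho>[of 0]])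
    show "\<exists>N. \<forall>n\<ge>N. ?u n / real n \<le> b"
      using le by (intro exI[of _ 1]) (auto simp: field_simps)
  qed
  ultimately have "is_rotation_number a b \<rho>"
    using \<rho> plus b_less by (auto simp: is_rotation_number_def)
  then show ?thesis by blast
qed

section \<open>The rotation number, integer displacements and the phase of an orbit\<close>

definition rho :: real where "rho = rotation_number a b"

lemma is_rotation_number_rho: "is_rotation_number a b rho"
proof -
  obtain \<rho> where \<rho>: "is_rotation_number a b \<rho>"
    using rotation_number_exists by blast
  have "\<rho>' = \<rho>" if "is_rotation_number a b \<rho>'" for \<rho>'
    using that \<rho> unfolding is_rotation_number_def by (meson LIMSEQ_unique)
  with \<rho> show ?thesis
    unfolding rho_def rotation_number_def by (rule theI)
qed

text \<open>An advance by at least \<open>p\<close> in \<open>d\<close> steps repeats, by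
  monotonicity and degree one, to an advance by at least \<open>k * p\<close> in
  \<open>k * d\<close> steps. Dividing by \<open>k\<close> and letting \<open>k\<close> grow gives
  the bound.\<close>

lemma F_minus_displacement_imp:
  assumes "x + of_int p \<le> (F_minus a b ^^ d) x"
  shows "of_int p \<le> real d * rho"
proof (cases "d = 0")
  case False
  let ?G = "F_minus a b ^^ d"
  have it: "x + real k * of_int p \<le> (?G ^^ k) x" for k
  proof (induction k)
    case (Suc k)
    have "x + real (Suc k) * of_int p = (x + of_int p) + of_int (int k * p)"
      by (simp add: algebra_simps)
    also have "\<dots> \<le> ?G x + of_int (int k * p)" using assms by simp
    also have "\<dots> = ?G (x + of_int (int k * p))"
      by (rule degree_one_funpow_add_int[OF F_minus_add_int, symmetric])
    also have "\<dots> \<le> ?G ((?G ^^ k) x)"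
      using Suc by (intro monoD[OF mono_pow[OF mono_F_minus]]) simp
    finally show ?case by simp
  qed simp
  have l1: "(\<lambda>k. x / real k + of_int p) \<longlonglongrightarrow> of_int p"
    using tendsto_add[OF lim_const_over_n[of x] tendsto_const] by simp
  have l2: "(\<lambda>k. real d * ((F_minus a b ^^ (k * d)) x / real (k * d))) \<longlonglongrightarrow> real d * rho"
  proof (rule tendsto_mult[OF tendsto_const])
    have "(\<lambda>n. (F_minus a b ^^ n) x / real n) \<longlonglongrightarrow> rho"
      using is_rotation_number_rho by (simp add: is_rotation_number_def)
    moreover have "filterlim (\<lambda>k. k * d) sequentially sequentially"
      using False by (intro filterlim_subseq strict_monoI) simp
    ultimately show "(\<lambda>k. (F_minus a b ^^ (k * d)) x / real (k * d)) \<longlonglongrightarrow> rho"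
      by (rule filterlim_compose)
  qed
  have le: "x / real k + of_int p \<le> real d * ((F_minus a b ^^ (k * d)) x / real (k * d))"
    if "k \<ge> 1" for k
  proof -
    have "(?G ^^ k) x = (F_minus a b ^^ (k * d)) x" by (simp add: funpow_mult mult.commute)
    then have "(x + real k * of_int p) / real k \<le> ((F_minus a b ^^ (k * d)) x) / real k"
      using it[of k] by (intro divide_right_mono) auto
    with that False show ?thesis by (simp add: add_divide_distrib)
  qed
  show ?thesis using le by (intro LIMSEQ_le[OF l1 l2]) blast
qed (use assms in auto)

text \<open>Mirror image of \<open>F_minus_displacement_imp\<close>: an advance by at most
  \<open>p\<close> is iterated along the lower branch.\<close>

lemma F_plus_displacement_imp:
  assumes "(F_plus a b ^^ d) x \<le> x + of_int p"
  shows "real d * rho \<le> of_int p"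
proof (cases "d = 0")
  case False
  let ?G = "F_plus a b ^^ d"
  have it: "(?G ^^ k) x \<le> x + real k * of_int p" for k
  proof (induction k)
    case (Suc k)
    have "?G ((?G ^^ k) x) \<le> ?G (x + of_int (int k * p))"
      using Suc by (intro monoD[OF mono_pow[OF mono_F_plus]]) simp
    also have "\<dots> = ?G x + of_int (int k * p)"
      by (rule degree_one_funpow_add_int[OF F_plus_add_int])
    also have "\<dots> \<le> (x + of_int p) + of_int (int k * p)" using assms by simp
    finally show ?case by (simp add: algebra_simps)
  qed simp
  have l1: "(\<lambda>k. x / real k + of_int p) \<longlonglongrightarrow> of_int p"
    using tendsto_add[OF lim_const_over_n[of x] tendsto_const] by simp
  have l2: "(\<lambda>k. real d * ((F_plus a b ^^ (k * d)) x / real (k * d))) \<longlonglongrightarrow> real d * rho"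
  proof (rule tendsto_mult[OF tendsto_const])
    have "(\<lambda>n. (F_plus a b ^^ n) x / real n) \<longlonglongrightarrow> rho"
      using is_rotation_number_rho by (simp add: is_rotation_number_def)
    moreover have "filterlim (\<lambda>k. k * d) sequentially sequentially"
      using False by (intro filterlim_subseq strict_monoI) simp
    ultimately show "(\<lambda>k. (F_plus a b ^^ (k * d)) x / real (k * d)) \<longlonglongrightarrow> rho"
      by (rule filterlim_compose)
  qed
  have le: "real d * ((F_plus a b ^^ (k * d)) x / real (k * d)) \<le> x / real k + of_int p"
    if "k \<ge> 1" for k
  proof -
    have "(?G ^^ k) x = (F_plus a b ^^ (k * d)) x" by (simp add: funpow_mult mult.commute)
    then have "((F_plus a b ^^ (k * d)) x) / real k \<le> (x + real k * of_int p) / real k"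
      using it[of k] by (intro divide_right_mono) auto
    with that False show ?thesis by (simp add: add_divide_distrib)
  qed
  show ?thesis using le by (intro LIMSEQ_le[OF l2 l1]) blast
qed (use assms in auto)

text \<open>As \<open>X\<close> lies between \<open>K\<close> and \<open>K + 1\<close>, its advance
  between two times differs from that of \<open>K\<close> by at most 1. The upper branch bounds this
  advance if \<open>m \<le> n\<close>, the lower branch otherwise, and the displacement lemmas
  compare it with \<open>rho\<close>.\<close>

lemma lift_orbit_balanced:
  assumes "lift_orbit X K"
  shows "of_int (K n) - real n * rho \<le> of_int (K m) + 1 - real m * rho"
proof (cases "m \<le> n")
  case True
  define d where "d = n - m"
  have n: "n = m + d" using True by (simp add: d_def)
  have "X m + of_int (K n - K m - 1) \<le> (F_minus a b ^^ d) (X m)"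
    using lift_orbit_le_F_minus[OF assms, of m d] lift_orbitD[OF assms, of m]
      lift_orbitD[OF assms, of n] n by simp
  from F_minus_displacement_imp[OF this] show ?thesis by (simp add: n algebra_simps)
next
  case False
  define d where "d = m - n"
  have m: "m = n + d" using False by (simp add: d_def)
  have "(F_plus a b ^^ d) (X n) \<le> X n + of_int (K m - K n + 1)"
    using F_plus_le_lift_orbit[OF assms, of d n] lift_orbitD[OF assms, of m]
      lift_orbitD[OF assms, of n] m by simp
  from F_plus_displacement_imp[OF this] show ?thesis by (simp add: m algebra_simps)
qed

text \<open>The phase is the supremum of the deviations \<open>K n - n * rho\<close>; by balance
  every \<open>K m + 1 - m * rho\<close> is an upper bound of them.\<close>

lemma lift_orbit_phase:
  assumes "lift_orbit X K"
  obtains \<theta> where "\<And>n. of_int (K n) \<le> real n * rho + \<theta>" "\<And>n. real n * rho + \<theta> \<le> of_int (K n) + 1"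
proof
  let ?S = "range (\<lambda>n. of_int (K n) - real n * rho)"
  have bdd: "bdd_above ?S"
    using lift_orbit_balanced[OF assms, of _ 0] by (auto intro!: bdd_aboveI2)
  show "of_int (K n) \<le> real n * rho + Sup ?S" for n
    using cSup_upper[OF _ bdd, of "of_int (K n) - real n * rho"] by auto
  have "Sup ?S \<le> of_int (K n) + 1 - real n * rho" for n
    using lift_orbit_balanced[OF assms] by (intro cSup_least) auto
  then show "real n * rho + Sup ?S \<le> of_int (K n) + 1" for n
    by (simp add: algebra_simps)
qed

text \<open>Each step of the orbit discards an integer \<open>k i\<close> from
  \<open>a * x i + b\<close>. \<open>K n\<close> is the sum of those discarded before time
  \<open>n\<close>, and the lift is \<open>x n + K n\<close>.\<close>

lemma orbit_imp_lift_orbit: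
  assumes "is_orbit a b x"
  obtains X K where "lift_orbit X K" "\<And>n. x n = X n - of_int (K n)"
proof -
  define k where "k i = a * x i + b - x (Suc i)" for i
  have k_int: "k i \<in> \<int>" for i
  proof -
    have "x (Suc i) \<in> f_pm a b (x i)" using assms by (simp add: is_orbit_def)
    \<comment> \<open>The second alternative is the ceiling minus 1, the integer removed by
      \<open>frac_plus\<close>.\<close>
    then have "k i = of_int \<lfloor>a * x i + b\<rfloor> \<or> k i = of_int (- 1 - \<lfloor>- (a * x i + b)\<rfloor>)"
      by (auto simp: k_def f_pm_def f_minus_def f_plus_def frac_plus_def frac_def)
    then show ?thesis by (metis Ints_of_int)
  qed
  define K where "K n = \<lfloor>\<Sum>i<n. k i\<rfloor>" for n
  have K: "of_int (K n) = (\<Sum>i<n. k i)" for n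
    unfolding K_def using k_int Ints_sum[of "{..<n}" k] by (auto elim!: Ints_cases)
  have "lift_orbit (\<lambda>n. x n + of_int (K n)) K"
    unfolding lift_orbit_def
  proof (intro allI conjI)
    fix n
    have "0 \<le> x n" "x n \<le> 1" using assms by (auto simp: is_orbit_def)
    then show "of_int (K n) \<le> x n + of_int (K n)" "x n + of_int (K n) \<le> of_int (K n) + 1" by auto
    show "x (Suc n) + of_int (K (Suc n)) = a * (x n + of_int (K n)) + b + (1 - a) * of_int (K n)"
      unfolding K by (simp add: k_def algebra_simps)
  qed
  then show thesis by (rule that) simp
qed

text \<open>A point of \<open>{0..1}\<close> congruent to \<open>y\<close> modulo 1 can only be
  \<open>frac y\<close> or \<open>frac_plus y\<close>. This criterion avoids deciding which branch
  is taken.\<close>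

lemma is_orbitI:
  assumes "\<And>n. 0 \<le> x n" "\<And>n. x n \<le> 1" "\<And>n. a * x n + b - x (Suc n) \<in> \<int>"
  shows "is_orbit a b x"
  unfolding is_orbit_def
proof (intro conjI allI)
  fix n
  show "x n \<in> {0..1}" using assms by simp
  obtain k where "a * x n + b - x (Suc n) = of_int k"
    using assms(3) by (auto elim: Ints_cases)
  then have k: "x (Suc n) = a * x n + b - of_int k" by simp
  have "0 \<le> x (Suc n)" "x (Suc n) \<le> 1" using assms by auto
  then have "k = \<lfloor>a * x n + b\<rfloor> \<or> k = - 1 - \<lfloor>- (a * x n + b)\<rfloor>"
    unfolding k by linarith
  then show "x (Suc n) \<in> f_pm a b (x n)"
    unfolding k by (auto simp: f_pm_def f_minus_def f_plus_def frac_plus_def frac_def)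
qed

text \<open>At the times \<open>n\<close> where \<open>n \<rho> + \<theta>\<close> is an integer, \<open>K n\<close> may take two values. For irrational
  \<open>\<rho>\<close> there is at most one such time. For \<open>\<rho> = p/q\<close> the lift orbits \<open>X n\<close> and \<open>X (n + q) - p\<close> are
  eventually ordered, so that \<open>K (n + q) - p - K n\<close> has eventually constant sign and the choice
  is eventually the same at all these times.\<close>

lemma lift_orbit_eventually_floor_irrational:
  assumes "lift_orbit X K" "rho \<notin> \<rat>"
  shows "\<exists>\<theta> N. \<forall>n\<ge>N. K n = \<lfloor>real n * rho + \<theta>\<rfloor>"
proof -
  obtain \<theta> where \<theta>: "\<And>n. of_int (K n) \<le> real n * rho + \<theta>" "\<And>n. real n * rho + \<theta> \<le> of_int (K n) + 1"
    using lift_orbit_phase[OF assms(1)] by blast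
  have uniq: "n = m" if "real n * rho + \<theta> = of_int k" "real m * rho + \<theta> = of_int l" for n m k l
  proof (rule ccontr)
    assume "n \<noteq> m"
    then have "rho = of_int (k - l) / of_int (int n - int m)"
      using that by (simp add: field_simps)
    then show False using assms(2) by (metis Rats_divide Rats_of_int)
  qed
  have "\<exists>N. \<forall>n\<ge>N. \<forall>k. real n * rho + \<theta> \<noteq> of_int k"
  proof (cases "\<exists>n k. real n * rho + \<theta> = of_int k")
    case True
    then obtain m l where "real m * rho + \<theta> = of_int l" by blast
    then have "\<forall>n\<ge>Suc m. \<forall>k. real n * rho + \<theta> \<noteq> of_int k" using uniq by fastforce
    then show ?thesis by blast
  qed blast
  then obtain N where N: "\<And>n k. n \<ge> N \<Longrightarrow> real n * rho + \<theta> \<noteq> of_int k" by blast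
  have "K n = \<lfloor>real n * rho + \<theta>\<rfloor>" if "n \<ge> N" for n
  proof -
    have "real n * rho + \<theta> \<noteq> of_int (K n + 1)" using N[OF that] .
    then show ?thesis using \<theta>[of n] by (intro floor_unique[symmetric]) auto
  qed
  then show ?thesis by blast
qed

lemma lift_orbit_eventually_floor_rational:
  assumes X: "lift_orbit X K" and q: "q > 0" and cop: "coprime p (int q)"
    and rho: "rho = of_int p / of_int (int q)"
  shows "\<exists>\<theta> N. \<forall>n\<ge>N. K n = \<lfloor>real n * rho + \<theta>\<rfloor>"
proof -
  obtain \<theta> where \<theta>: "\<And>n. of_int (K n) \<le> real n * rho + \<theta>" "\<And>n. real n * rho + \<theta> \<le> of_int (K n) + 1"
    using lift_orbit_phase[OF X] by blast
  define y where "y n = real n * rho + \<theta>" for n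
  have K_cases: "K n = \<lfloor>y n\<rfloor> \<or> y n = of_int (K n + 1)" for n
    using \<theta>[of n] unfolding y_def by (simp add: floor_eq_iff) linarith
  have q_rho: "real q * rho = of_int p" using q by (simp add: rho)
  have y_diff: "real q * y n = real q * y m + of_int ((int n - int m) * p)" for m n
    unfolding of_int_mult q_rho[symmetric] by (simp add: y_def algebra_simps)
  have y_add: "y (n + j * q) = y n + of_int (int j * p)" for n j
    using q by (simp add: y_def rho field_simps)
  \<comment> \<open>Two integer values of \<open>y\<close> force \<open>q\<close> to divide
    \<open>(n - m) * p\<close>, hence \<open>n - m\<close>: the ambiguous times lie in one residue
    class modulo \<open>q\<close>.\<close>
  have y_Ints: "\<exists>j. n = m + j * q" if Z: "y m \<in> \<int>" "y n \<in> \<int>" and "m \<le> n" for m n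
  proof -
    have "y n - y m \<in> \<int>" using Z by simp
    then obtain k where "y n - y m = of_int k" by (auto elim: Ints_cases)
    then have "y n = y m + of_int k" by simp
    then have "real_of_int ((int n - int m) * p) = real_of_int (k * int q)"
      using y_diff[of n m] by (simp add: distrib_left mult.commute)
    then have "(int n - int m) * p = k * int q" by linarith
    then have "int q dvd (int n - int m) * p" by simp
    then have "int q dvd int n - int m" using cop by (simp add: coprime_commute coprime_dvd_mult_left_iff)
    then have "q dvd n - m" using \<open>m \<le> n\<close> by (metis int_dvd_int_iff of_nat_diff)
    then show ?thesis using \<open>m \<le> n\<close> by (metis dvd_def le_add_diff_inverse mult.commute)
  qed
  let ?Y = "\<lambda>n. X (n + q) + of_int (- p)" and ?L = "\<lambda>n. K (n + q) + (- p)"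
  have Y: "lift_orbit ?Y ?L" by (rule lift_orbit_shift[OF X])
  \<comment> \<open>A strict inequality between the two lift orbits persists and orders their
    integer parts. If there is never one, the orbits coincide and so do the integer parts.\<close>
  have mono: "(\<exists>N. \<forall>n\<ge>N. K n \<le> ?L n) \<or> (\<exists>N. \<forall>n\<ge>N. ?L n \<le> K n)"
  proof (cases "\<exists>n. X n < ?Y n \<or> ?Y n < X n")
    case True
    then show ?thesis
      using lift_orbit_less[OF X Y] lift_orbit_less[OF Y X]
        lift_orbit_less_imp_le[OF X Y] lift_orbit_less_imp_le[OF Y X] by meson
  next
    case False
    then have eq: "X n = ?Y n" for n by (meson linorder_neqE)
    have "K n = ?L n" for n by (rule lift_orbit_K_determined[OF X Y eq eq])
    then show ?thesis by (metis order_refl)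
  qed
  have "(\<exists>M. \<forall>n\<ge>M. K n = \<lfloor>y n\<rfloor>) \<or> (\<exists>M. \<forall>n\<ge>M. y n \<in> \<int> \<longrightarrow> y n = of_int (K n + 1))"
    using mono
  proof (elim disjE exE)
    fix N assume N: "\<forall>n\<ge>N. K n \<le> ?L n"
    show ?thesis
    proof (cases "\<exists>m\<ge>N. y m \<in> \<int> \<and> K m = \<lfloor>y m\<rfloor>")
      case True
      then obtain m where m: "m \<ge> N" "y m \<in> \<int>" "K m = \<lfloor>y m\<rfloor>" by blast
      \<comment> \<open>Relative to the drift \<open>p\<close> per \<open>q\<close> steps,
        \<open>K\<close> can only rise here. Once it has the upper value
        \<open>\<lfloor>y\<rfloor>\<close> it must keep it, as it cannot go higher; dually,
        \<open>bottom\<close> below propagates the lower value.\<close>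
      have top: "K (m + j * q) = \<lfloor>y (m + j * q)\<rfloor>" for j
      proof (induction j)
        case (Suc j)
        have "K (m + j * q) \<le> K (m + j * q + q) - p" using N m(1) by simp
        then have "K (m + Suc j * q) \<ge> \<lfloor>y (m + Suc j * q)\<rfloor>"
          using Suc y_add[of m j] y_add[of m "Suc j"] by (simp add: algebra_simps)
        moreover have "K (m + Suc j * q) \<le> \<lfloor>y (m + Suc j * q)\<rfloor>"
          using \<theta>(1) unfolding y_def le_floor_iff .
        ultimately show ?case by linarith
      qed (use m in simp)
      have "K n = \<lfloor>y n\<rfloor>" if "n \<ge> m" for n
      proof (cases "y n \<in> \<int>")
        case True
        then show ?thesis using y_Ints[OF m(2) True that] top by auto
      next
        case False
        then show ?thesis using K_cases[of n] by (metis Ints_of_int)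
      qed
      then show ?thesis by blast
    qed (use K_cases in blast)
  next
    fix N assume N: "\<forall>n\<ge>N. ?L n \<le> K n"
    show ?thesis
    proof (cases "\<exists>m\<ge>N. y m = of_int (K m + 1)")
      case True
      then obtain m where m: "m \<ge> N" "y m = of_int (K m + 1)" by blast
      have bottom: "y (m + j * q) = of_int (K (m + j * q) + 1)" for j
      proof (induction j)
        case (Suc j)
        have "K (m + j * q + q) - p \<le> K (m + j * q)" using N m(1) by simp
        then have "K (m + Suc j * q) \<le> K (m + j * q) + p" by (simp add: algebra_simps)
        then have "real_of_int (K (m + Suc j * q)) \<le> real_of_int (K (m + j * q) + p)"
          by (simp only: of_int_le_iff)
        then have "real_of_int (K (m + Suc j * q)) + 1 \<le> y (m + Suc j * q)"
          using Suc y_add[of m j] y_add[of m "Suc j"] by (simp add: algebra_simps)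
        moreover have "y (m + Suc j * q) \<le> real_of_int (K (m + Suc j * q)) + 1"
          using \<theta>(2) unfolding y_def .
        ultimately show ?case by simp
      qed (use m in simp)
      have "y n = of_int (K n + 1)" if "n \<ge> m" "y n \<in> \<int>" for n
        using y_Ints[of m n] that m(2) bottom by auto
      then show ?thesis by blast
    qed (use K_cases in blast)
  qed
  then show ?thesis
  proof (elim disjE exE)
    fix M assume M: "\<forall>n\<ge>M. y n \<in> \<int> \<longrightarrow> y n = of_int (K n + 1)"
    show ?thesis
    proof (cases "\<exists>m. y m \<in> \<int>")
      case False
      then have "\<forall>n\<ge>0. K n = \<lfloor>real n * rho + \<theta>\<rfloor>"
        using K_cases unfolding y_def by (metis Ints_of_int)
      then show ?thesis by blast
    next
      case True
      then obtain m k where m: "y m = of_int k" by (auto elim: Ints_cases)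
      \<comment> \<open>Since some \<open>y m\<close> is an integer, all values of \<open>y\<close>
        are multiples of \<open>1 / q\<close>. Lowering the phase by \<open>1 / q\<close> therefore
        moves integer values just below the integer and leaves every other floor unchanged.\<close>
      have "K n = \<lfloor>real n * rho + (\<theta> - 1 / real q)\<rfloor>" if "n \<ge> M" for n
      proof (cases "y n \<in> \<int>")
        case True
        then have "real n * rho + (\<theta> - 1 / real q) = of_int (K n) + (1 - 1 / real q)"
          using M that by (simp add: y_def)
        moreover have "0 \<le> 1 - 1 / real q" "1 - 1 / real q < 1" using q by auto
        ultimately show ?thesis by (intro floor_unique[symmetric]) linarith+
      next
        case False
        then have K: "K n = \<lfloor>y n\<rfloor>" using K_cases[of n] by (metis Ints_of_int)
        define l where "l = k * int q + (int n - int m) * p"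
        have l: "real q * y n = of_int l"
          using y_diff[of n m] m by (simp add: l_def mult.commute)
        have "y n \<noteq> of_int (K n)" using False by (metis Ints_of_int)
        then have "of_int (K n) < y n" by (metis K less_eq_real_def of_int_floor_le)
        then have "real_of_int (int q * K n) < real_of_int l"
          using q by (simp add: l[symmetric])
        then have "int q * K n + 1 \<le> l" by linarith
        then have "real_of_int (int q * K n + 1) \<le> real_of_int l" by (simp only: of_int_le_iff)
        then have "of_int (K n) \<le> y n - 1 / real q"
          using q by (simp add: l[symmetric] field_simps)
        moreover have "y n < of_int (K n) + 1" "0 < 1 / real q"
          using q unfolding K by auto
        ultimately show ?thesis
          unfolding y_def by (intro floor_unique[symmetric]) linarith+
      qed
      then show ?thesis by blast
    qed
  qed (unfold y_def, blast)
qed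

lemma lift_orbit_eventually_floor:
  assumes "lift_orbit X K"
  shows "\<exists>\<theta> N. \<forall>n\<ge>N. K n = \<lfloor>real n * rho + \<theta>\<rfloor>"
proof (cases "rho \<in> \<rat>")
  case True
  then obtain p r where r: "r > 0" "coprime p r" "rho = of_int p / of_int r"
    by (metis Rats_cases')
  then show ?thesis
    using lift_orbit_eventually_floor_rational[OF assms, of "nat r" p] by simp
qed (rule lift_orbit_eventually_floor_irrational[OF assms])

section \<open>The function \<open>phi\<close> and the asymptotics of orbits\<close>

lemma summable_phi: "summable (\<lambda>j. a ^ j * of_int \<lfloor>y - (real j + 1) * r\<rfloor>)"
proof (rule summable_comparison_test')
  \<comment> \<open>The floors grow at most linearly in \<open>j\<close>, so geometric and
    differentiated geometric series dominate.\<close>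
  have "summable (\<lambda>j. a ^ j * (\<bar>y\<bar> + 1) + of_nat (Suc j) * a ^ j * \<bar>r\<bar>)"
    using a_pos a_less geometric_deriv_sums[of a]
    by (intro summable_add summable_mult2) (auto simp: sums_iff intro: summable_geometric)
  then show "summable (\<lambda>j. a ^ j * (\<bar>y\<bar> + 1 + real (Suc j) * \<bar>r\<bar>))"
    by (simp add: algebra_simps)
  fix j
  have "\<bar>(real j + 1) * r\<bar> = real (Suc j) * \<bar>r\<bar>" by (simp add: abs_mult)
  then have "\<bar>real_of_int \<lfloor>y - (real j + 1) * r\<rfloor>\<bar> \<le> \<bar>y\<bar> + 1 + real (Suc j) * \<bar>r\<bar>"
    by linarith
  then show "norm (a ^ j * of_int \<lfloor>y - (real j + 1) * r\<rfloor>) \<le> a ^ j * (\<bar>y\<bar> + 1 + real (Suc j) * \<bar>r\<bar>)"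
    using a_pos by (auto simp: abs_mult intro!: mult_left_mono)
qed

lemma mono_phi: "mono (phi a b r)"
  unfolding phi_def using a_pos a_less
  by (intro monoI add_left_mono mult_left_mono suminf_le summable_phi)
     (auto intro!: mult_left_mono floor_mono)

lemma phi_add_int: "phi a b r (y + of_int k) = phi a b r y + of_int k"
proof -
  have "(\<Sum>j. a ^ j * of_int \<lfloor>y + of_int k - (real j + 1) * r\<rfloor>)
      = (\<Sum>j. a ^ j * of_int \<lfloor>y - (real j + 1) * r\<rfloor> + a ^ j * of_int k)"
  proof (rule suminf_cong)
    fix j
    have "y + of_int k - (real j + 1) * r = (y - (real j + 1) * r) + of_int k" by simp
    then have "\<lfloor>y + of_int k - (real j + 1) * r\<rfloor> = \<lfloor>y - (real j + 1) * r\<rfloor> + k"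
      by (simp only: floor_add_int[symmetric])
    then show "a ^ j * real_of_int \<lfloor>y + of_int k - (real j + 1) * r\<rfloor>
        = a ^ j * of_int \<lfloor>y - (real j + 1) * r\<rfloor> + a ^ j * of_int k"
      by (simp add: algebra_simps)
  qed
  also have "\<dots> = (\<Sum>j. a ^ j * of_int \<lfloor>y - (real j + 1) * r\<rfloor>) + of_int k / (1 - a)"
    using a_pos a_less
    by (subst suminf_add[OF summable_phi, symmetric])
       (auto simp: suminf_mult2[symmetric] suminf_geometric intro!: summable_mult2 summable_geometric)
  finally show ?thesis using a_less by (simp add: phi_def distrib_left)
qed

text \<open>The term at index 0 yields \<open>\<lfloor>y\<rfloor>\<close> and the tail is
  \<open>a\<close> times the series at \<open>y\<close>; \<open>b / (1 - a)\<close> is the fixed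
  point of \<open>t \<mapsto> a * t + b\<close>.\<close>

lemma phi_add_rotation: "phi a b r (y + r) = a * phi a b r y + b + (1 - a) * of_int \<lfloor>y\<rfloor>"
proof -
  let ?t = "\<lambda>j. a ^ j * of_int \<lfloor>y + r - (real j + 1) * r\<rfloor>"
  have "suminf ?t = ?t 0 + (\<Sum>j. ?t (Suc j))"
    using suminf_split_head[OF summable_phi[of "y + r" r]] by simp
  also have "(\<lambda>j. ?t (Suc j)) = (\<lambda>j. a * (a ^ j * of_int \<lfloor>y - (real j + 1) * r\<rfloor>))"
    by (simp add: algebra_simps)
  also have "suminf \<dots> = a * (\<Sum>j. a ^ j * of_int \<lfloor>y - (real j + 1) * r\<rfloor>)"
    by (rule suminf_mult[OF summable_phi])
  finally show ?thesis using a_less by (simp add: phi_def field_simps)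
qed

lemma phi_frac: "phi a b r (frac y) = phi a b r y - of_int \<lfloor>y\<rfloor>"
  using phi_add_int[of r y "- \<lfloor>y\<rfloor>"] by (simp add: frac_def)

text \<open>Once \<open>K n\<close> is the floor of \<open>n * rho + \<theta>\<close>, the lift and
  \<open>phi\<close> follow the same affine recursion, so their difference shrinks by the factor
  \<open>a\<close> at each step. Subtracting \<open>K n\<close> from both returns to
  \<open>{0..1}\<close>.\<close>

lemma orbit_asymptotic:
  assumes "is_orbit a b x"
  obtains \<theta> where "(\<lambda>n. x n - phi a b rho (frac (real n * rho + \<theta>))) \<longlonglongrightarrow> 0"
proof -
  obtain X K where X: "lift_orbit X K" "\<And>n. x n = X n - of_int (K n)"
    using orbit_imp_lift_orbit[OF assms] by blast
  obtain \<theta> N where N: "\<And>n. n \<ge> N \<Longrightarrow> K n = \<lfloor>real n * rho + \<theta>\<rfloor>"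
    using lift_orbit_eventually_floor[OF X(1)] by blast
  define e where "e n = X n - phi a b rho (real n * rho + \<theta>)" for n
  have e: "e (N + i) = a ^ i * e N" for i
  proof (induction i)
    case (Suc i)
    have "real (N + Suc i) * rho + \<theta> = (real (N + i) * rho + \<theta>) + rho"
      by (simp add: algebra_simps)
    then have "phi a b rho (real (N + Suc i) * rho + \<theta>)
        = a * phi a b rho (real (N + i) * rho + \<theta>) + b + (1 - a) * of_int (K (N + i))"
      using N[of "N + i"] by (simp only: phi_add_rotation le_add1)
    then have "e (N + Suc i) = a * e (N + i)"
      using lift_orbitD(3)[OF X(1), of "N + i"] by (simp add: e_def right_diff_distrib)
    with Suc show ?case by simp
  qed simp
  have "(\<lambda>i. e (i + N)) \<longlonglongrightarrow> 0"
    unfolding add.commute[of _ N] e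
    using a_pos a_less by (intro tendsto_mult_left_zero LIMSEQ_realpow_zero) auto
  then have "e \<longlonglongrightarrow> 0" by (rule LIMSEQ_offset)
  moreover have "eventually (\<lambda>n. e n = x n - phi a b rho (frac (real n * rho + \<theta>))) sequentially"
    using N by (intro eventually_sequentiallyI[of N]) (simp add: e_def phi_frac X(2))
  ultimately have "(\<lambda>n. x n - phi a b rho (frac (real n * rho + \<theta>))) \<longlonglongrightarrow> 0"
    by (rule Lim_transform_eventually)
  then show thesis by (rule that)
qed

end

subsection \<open>Equidistribution of rotations\<close>

text \<open>A signed count of the integers in the intervals from \<open>i * \<rho> + \<beta>\<close>
  to \<open>i * \<rho> + \<beta> + c\<close>. It makes sense for every real \<open>c\<close>, so
  lengths can be added and negated.\<close>

definition floor_sum_diff :: "real \<Rightarrow> real \<Rightarrow> real \<Rightarrow> nat \<Rightarrow> real" where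
  "floor_sum_diff \<rho> c \<beta> n =
     (\<Sum>i<n. of_int \<lfloor>real i * \<rho> + \<beta> + c\<rfloor> - of_int \<lfloor>real i * \<rho> + \<beta>\<rfloor>)"

text \<open>All phases \<open>\<beta>\<close> are included because adding lengths shifts the phase
  of one summand.\<close>

definition equidistributed_length :: "real \<Rightarrow> real \<Rightarrow> bool" where
  "equidistributed_length \<rho> c \<longleftrightarrow> (\<forall>\<beta>. (\<lambda>n. floor_sum_diff \<rho> c \<beta> n / real n) \<longlonglongrightarrow> c)"

text \<open>For \<open>c\<close> in \<open>{0..1}\<close>, subtracting \<open>c\<close> from
  \<open>y\<close> lowers the floor by one exactly when \<open>frac y < c\<close>.\<close>

lemma card_frac_less:
  assumes "0 \<le> c" "c \<le> 1"
  shows "real (card {i. i < n \<and> frac (real i * \<rho> + \<theta>) < c}) = floor_sum_diff \<rho> c (\<theta> - c) n"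
proof -
  have "indicator {i. frac (real i * \<rho> + \<theta>) < c} i
      = real_of_int \<lfloor>real i * \<rho> + (\<theta> - c) + c\<rfloor> - real_of_int \<lfloor>real i * \<rho> + (\<theta> - c)\<rfloor>" for i
  proof -
    define y where "y = real i * \<rho> + \<theta>"
    have y: "real i * \<rho> + (\<theta> - c) + c = y" "real i * \<rho> + (\<theta> - c) = y - c"
      by (simp_all add: y_def)
    have "\<lfloor>y - c\<rfloor> = (if frac y < c then \<lfloor>y\<rfloor> - 1 else \<lfloor>y\<rfloor>)"
    proof (cases "frac y < c")
      case True
      then have "\<lfloor>y - c\<rfloor> = \<lfloor>y\<rfloor> - 1"
        using assms unfolding frac_def by linarith
      then show ?thesis using True by simp
    next
      case False
      then have "\<lfloor>y - c\<rfloor> = \<lfloor>y\<rfloor>"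
        using assms unfolding frac_def by linarith
      then show ?thesis using False by simp
    qed
    then show ?thesis unfolding y by (simp add: y_def[symmetric] indicator_def)
  qed
  then have "floor_sum_diff \<rho> c (\<theta> - c) n = (\<Sum>i<n. indicator {i. frac (real i * \<rho> + \<theta>) < c} i)"
    by (simp add: floor_sum_diff_def)
  also have "\<dots> = real (card {i. i < n \<and> frac (real i * \<rho> + \<theta>) < c})"
    by (simp add: indicator_def sum.If_cases Int_def)
  finally show ?thesis by simp
qed

lemma equidistributed_length_of_int: "equidistributed_length \<rho> (of_int k)"
  unfolding equidistributed_length_def
proof
  fix \<beta>
  have "floor_sum_diff \<rho> (of_int k) \<beta> n / real n = of_int k" if "n \<ge> 1" for n
    using that by (simp add: floor_sum_diff_def)
  then show "(\<lambda>n. floor_sum_diff \<rho> (of_int k) \<beta> n / real n) \<longlonglongrightarrow> of_int k"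
    by (intro tendsto_eventually eventually_sequentiallyI)
qed

text \<open>For \<open>c = \<rho>\<close> the summands are consecutive differences, so the sum
  telescopes and differs from \<open>n * \<rho>\<close> by at most 1.\<close>

lemma equidistributed_length_self: "equidistributed_length \<rho> \<rho>"
  unfolding equidistributed_length_def
proof
  fix \<beta>
  have tel: "floor_sum_diff \<rho> \<rho> \<beta> n = of_int \<lfloor>real n * \<rho> + \<beta>\<rfloor> - of_int \<lfloor>\<beta>\<rfloor>" for n
    using sum_lessThan_telescope[of "\<lambda>i. real_of_int \<lfloor>real i * \<rho> + \<beta>\<rfloor>" n]
    by (simp add: floor_sum_diff_def algebra_simps)
  have "(\<lambda>n. (floor_sum_diff \<rho> \<rho> \<beta> n - real n * \<rho>) / real n) \<longlonglongrightarrow> 0"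
  proof (rule Lim_null_comparison[OF _ lim_const_over_n[of 1]])
    have "\<bar>floor_sum_diff \<rho> \<rho> \<beta> n - real n * \<rho>\<bar> \<le> 1" for n
      unfolding tel by linarith
    then show "\<forall>\<^sub>F n in sequentially. norm ((floor_sum_diff \<rho> \<rho> \<beta> n - real n * \<rho>) / real n) \<le> 1 / real n"
      by (intro always_eventually) (auto intro!: divide_right_mono simp: abs_divide)
  qed
  then have "(\<lambda>n. (floor_sum_diff \<rho> \<rho> \<beta> n - real n * \<rho>) / real n + \<rho>) \<longlonglongrightarrow> 0 + \<rho>"
    by (intro tendsto_add tendsto_const)
  moreover
  have "(floor_sum_diff \<rho> \<rho> \<beta> n - real n * \<rho>) / real n + \<rho> = floor_sum_diff \<rho> \<rho> \<beta> n / real n"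
    if "n \<ge> 1" for n
    using that by (simp add: diff_divide_distrib)
  then have "\<forall>\<^sub>F n in sequentially.
      (floor_sum_diff \<rho> \<rho> \<beta> n - real n * \<rho>) / real n + \<rho> = floor_sum_diff \<rho> \<rho> \<beta> n / real n"
    by (intro eventually_sequentiallyI)
  ultimately show "(\<lambda>n. floor_sum_diff \<rho> \<rho> \<beta> n / real n) \<longlonglongrightarrow> \<rho>"
    using Lim_transform_eventually by fastforce
qed

text \<open>The jump by \<open>c + d\<close> is split at the intermediate phase
  \<open>\<beta> + d\<close>.\<close>

lemma equidistributed_length_add:
  assumes "equidistributed_length \<rho> c" "equidistributed_length \<rho> d"
  shows "equidistributed_length \<rho> (c + d)"
  unfolding equidistributed_length_def
proof
  fix \<beta>
  have "floor_sum_diff \<rho> (c + d) \<beta> n = floor_sum_diff \<rho> c (\<beta> + d) n + floor_sum_diff \<rho> d \<beta> n" for n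
    by (simp add: floor_sum_diff_def sum.distrib[symmetric] add_ac)
  then show "(\<lambda>n. floor_sum_diff \<rho> (c + d) \<beta> n / real n) \<longlonglongrightarrow> c + d"
    using assms unfolding equidistributed_length_def
    by (simp add: add_divide_distrib tendsto_add)
qed

lemma equidistributed_length_minus:
  assumes "equidistributed_length \<rho> c"
  shows "equidistributed_length \<rho> (- c)"
  unfolding equidistributed_length_def
proof
  fix \<beta>
  have "floor_sum_diff \<rho> (- c) \<beta> n = - floor_sum_diff \<rho> c (\<beta> - c) n" for n
    by (simp add: floor_sum_diff_def sum_negf[symmetric] algebra_simps)
  then show "(\<lambda>n. floor_sum_diff \<rho> (- c) \<beta> n / real n) \<longlonglongrightarrow> - c"
    using assms unfolding equidistributed_length_def by (simp add: tendsto_minus)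
qed

lemma equidistributed_length_int_combination:
  "equidistributed_length \<rho> (of_int m * \<rho> + of_int k)"
proof -
  have nat: "equidistributed_length \<rho> (real n * \<rho>)" for n
  proof (induction n)
    case 0
    show ?case using equidistributed_length_of_int[of \<rho> 0] by simp
  next
    case (Suc n)
    then show ?case
      using equidistributed_length_add[OF Suc equidistributed_length_self] by (simp add: algebra_simps)
  qed
  have "equidistributed_length \<rho> (of_int m * \<rho>)"
  proof (cases m rule: int_cases2)
    case (nonneg n)
    then show ?thesis using nat[of n] by simp
  next
    case (nonpos n)
    then show ?thesis using equidistributed_length_minus[OF nat[of n]] by simp
  qed
  then show ?thesis by (intro equidistributed_length_add equidistributed_length_of_int)
qed

text \<open>Integer combinations of \<open>\<rho>\<close> and 1 are dense, and the count is monotone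
  in the length, so an arbitrary \<open>c\<close> is squeezed between equidistributed
  lengths.\<close>

lemma equidistributed_length_irrational:
  assumes "\<rho> \<notin> \<rat>"
  shows "equidistributed_length \<rho> c"
proof -
  have dense: "\<exists>d. equidistributed_length \<rho> d \<and> u < d \<and> d < v" if "u < v" for u v
  proof -
    have "(v - u) / 2 > 0" using that by simp
    then obtain h k where "\<bar>of_int k * \<rho> - of_int h - (u + v) / 2\<bar> < (v - u) / 2"
      using sequence_of_fractional_parts_is_dense[OF assms] by metis
    moreover define d where "d = of_int k * \<rho> + of_int (- h)"
    ultimately have "\<bar>d - (u + v) / 2\<bar> < (v - u) / 2" by simp
    then have "u < d \<and> d < v" unfolding abs_less_iff by (simp add: field_simps)
    then show ?thesis unfolding d_def using equidistributed_length_int_combination by blast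
  qed
  have mono: "floor_sum_diff \<rho> d \<beta> n / real n \<le> floor_sum_diff \<rho> d' \<beta> n / real n"
    if "d \<le> d'" for d d' \<beta> n
    unfolding floor_sum_diff_def using that
    by (intro divide_right_mono sum_mono diff_right_mono) (auto intro!: floor_mono)
  show ?thesis
    unfolding equidistributed_length_def
  proof (intro allI order_tendstoI)
    fix \<beta> u assume "u < c"
    then obtain d where d: "equidistributed_length \<rho> d" "u < d" "d < c" using dense by blast
    have "\<forall>\<^sub>F n in sequentially. u < floor_sum_diff \<rho> d \<beta> n / real n"
      by (rule order_tendstoD(1)[OF _ d(2)]) (use d(1) in \<open>simp add: equidistributed_length_def\<close>)
    then show "\<forall>\<^sub>F n in sequentially. u < floor_sum_diff \<rho> c \<beta> n / real n"
    proof eventually_elim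
      case (elim n)
      then show ?case using mono[of d c \<beta> n] d(3) by linarith
    qed
  next
    fix \<beta> v assume "c < v"
    then obtain d where d: "equidistributed_length \<rho> d" "c < d" "d < v" using dense by blast
    have "\<forall>\<^sub>F n in sequentially. floor_sum_diff \<rho> d \<beta> n / real n < v"
      by (rule order_tendstoD(2)[OF _ d(3)]) (use d(1) in \<open>simp add: equidistributed_length_def\<close>)
    then show "\<forall>\<^sub>F n in sequentially. floor_sum_diff \<rho> c \<beta> n / real n < v"
    proof eventually_elim
      case (elim n)
      then show ?case using mono[of c d \<beta> n] d(2) by linarith
    qed
  qed
qed

lemma frequency_frac_less:
  assumes "equidistributed_length \<rho> c" "0 \<le> c" "c \<le> 1"
  shows "(\<lambda>n. real (card {i. i < n \<and> frac (real i * \<rho> + \<theta>) < c}) / real n) \<longlonglongrightarrow> c"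
  using assms(1) unfolding card_frac_less[OF assms(2,3)] equidistributed_length_def by blast

lemma coprime_multiple_cong:
  fixes p :: int
  assumes "coprime p (int q)" "q > 0"
  obtains m :: nat where "m > 0" "int q dvd int m * p - k"
proof -
  obtain u v where uv: "u * p + v * int q = 1"
    using bezout_int[of p "int q"] assms(1) by auto
  \<comment> \<open>The Bezout solution is reduced modulo \<open>q\<close>; adding \<open>q\<close>
    makes it positive, as \<open>phi_strict\<close> requires for the index
    \<open>m - 1\<close>.\<close>
  define m where "m = nat ((u * k) mod int q) + q"
  have "int m = (u * k) mod int q + int q" using assms(2) by (simp add: m_def)
  then have m: "int m = u * k - int q * (u * k div int q) + int q" by (simp add: minus_mult_div_eq_mod)
  have "int m * p - k = int q * ((1 - u * k div int q) * p) + k * (u * p - 1)"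
    unfolding m by (simp add: algebra_simps)
  also have "u * p - 1 = - (v * int q)" using uv by simp
  finally have "int q dvd int m * p - k" by simp
  moreover have "m > 0" using assms(2) by (simp add: m_def)
  ultimately show thesis by (rule that[rotated])
qed

text \<open>Solving \<open>m * p\<close> congruent to \<open>j\<close> modulo \<open>q\<close>
  writes \<open>j / q\<close> as an integer combination of \<open>\<rho>\<close> and 1.\<close>

lemma equidistributed_length_rational:
  assumes "coprime p (int q)" "q > 0" "\<rho> = of_int p / of_int (int q)"
  shows "equidistributed_length \<rho> (of_int j / real q)"
proof -
  obtain m where "int q dvd int m * p - j"
    using coprime_multiple_cong[OF assms(1,2)] by blast
  then obtain l where "int m * p - j = int q * l" by (auto elim: dvdE)
  then have "j = int m * p + int q * (- l)" by simp
  then have "real_of_int j = real m * of_int p + real q * of_int (- l)"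
    by (metis of_int_add of_int_mult of_int_of_nat_eq)
  then have "of_int j / real q = of_int (int m) * \<rho> + of_int (- l)"
    using assms(2,3) by (simp add: field_simps)
  then show ?thesis by (metis equidistributed_length_int_combination)
qed

section \<open>Empirical distribution functions and their stability\<close>

lemma cdf_empirical_measure:
  assumes "n > 0"
  shows "cdf (empirical_measure x n) t = real (card {i. i < n \<and> x i \<le> t}) / real n"
proof -
  have m: "x \<in> measurable (uniform_count_measure {..<n}) borel"
    by (simp add: measurable_def sets_uniform_count_measure space_uniform_count_measure)
  have "cdf (empirical_measure x n) t = measure (uniform_count_measure {..<n}) (x -` {..t} \<inter> {..<n})"
    unfolding cdf_def empirical_measure_def
    using m by (simp add: measure_distr space_uniform_count_measure)
  also have "\<dots> = card (x -` {..t} \<inter> {..<n}) / card {..<n}"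
    by (rule measure_uniform_count_measure) auto
  also have "x -` {..t} \<inter> {..<n} = {i. i < n \<and> x i \<le> t}" by auto
  finally show ?thesis by simp
qed

text \<open>Up to finitely many early indices, the count for \<open>x\<close> at level
  \<open>t\<close> lies between those for \<open>z\<close> at \<open>t - \<delta>\<close> and
  \<open>t + \<delta>\<close>. Continuity of \<open>M\<close> at \<open>t\<close> makes these limits
  close to \<open>M t\<close>.\<close>

lemma frequency_perturbation:
  fixes x z :: "nat \<Rightarrow> real"
  assumes xz: "(\<lambda>n. x n - z n) \<longlonglongrightarrow> 0"
    and z: "\<And>t. (\<lambda>n. real (card {i. i < n \<and> z i \<le> t}) / real n) \<longlonglongrightarrow> M t"
    and cont: "isCont M t"
  shows "(\<lambda>n. real (card {i. i < n \<and> x i \<le> t}) / real n) \<longlonglongrightarrow> M t"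
proof -
  have card_le: "\<exists>N. \<forall>n. real (card {i. i < n \<and> u i \<le> s}) \<le> real (card {i. i < n \<and> v i \<le> s + \<delta>}) + real N"
    if "(\<lambda>n. u n - v n) \<longlonglongrightarrow> 0" "\<delta> > 0" for u v :: "nat \<Rightarrow> real" and s \<delta>
  proof -
    have "\<forall>\<^sub>F n in sequentially. \<bar>u n - v n\<bar> < \<delta>"
      using tendstoD[OF that] by (simp add: dist_real_def)
    then obtain N where N: "\<And>n. n \<ge> N \<Longrightarrow> \<bar>u n - v n\<bar> < \<delta>"
      unfolding eventually_sequentially by blast
    have "card {i. i < n \<and> u i \<le> s} \<le> card {i. i < n \<and> v i \<le> s + \<delta>} + N" for n
    proof -
      have "{i. i < n \<and> u i \<le> s} \<subseteq> {i. i < n \<and> v i \<le> s + \<delta>} \<union> {..<N}"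
      proof
        fix i assume "i \<in> {i. i < n \<and> u i \<le> s}"
        then show "i \<in> {i. i < n \<and> v i \<le> s + \<delta>} \<union> {..<N}"
          using N[of i] by (cases "i < N") (auto simp: abs_less_iff)
      qed
      then have "card {i. i < n \<and> u i \<le> s} \<le> card ({i. i < n \<and> v i \<le> s + \<delta>} \<union> {..<N})"
        by (intro card_mono) auto
      then show ?thesis using card_Un_le[of "{i. i < n \<and> v i \<le> s + \<delta>}" "{..<N}"] by simp
    qed
    then have "real (card {i. i < n \<and> u i \<le> s}) \<le> real (card {i. i < n \<and> v i \<le> s + \<delta>} + N)" for n
      by (simp only: of_nat_le_iff)
    then show ?thesis unfolding of_nat_add by blast
  qed
  have zx: "(\<lambda>n. z n - x n) \<longlonglongrightarrow> 0"
    using tendsto_minus[OF xz] by simp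
  have lim: "(\<lambda>n. real N / real n) \<longlonglongrightarrow> 0" for N by (rule lim_const_over_n)
  show ?thesis
  proof (rule order_tendstoI)
    fix A assume "A < M t"
    with cont have "\<forall>\<^sub>F s in at t. A < M s" unfolding isCont_def by (rule order_tendstoD)
    then obtain d where d: "d > 0" "\<And>s. s \<noteq> t \<Longrightarrow> dist s t < d \<Longrightarrow> A < M s"
      unfolding eventually_at by auto
    define \<delta> where "\<delta> = d / 2"
    have \<delta>: "\<delta> > 0" "A < M (t - \<delta>)" using d by (auto simp: \<delta>_def dist_real_def)
    obtain N where N: "\<And>n. real (card {i. i < n \<and> z i \<le> t - \<delta>}) \<le> real (card {i. i < n \<and> x i \<le> t}) + real N"
      using card_le[OF zx \<delta>(1), of "t - \<delta>"] by auto
    have "(\<lambda>n. real (card {i. i < n \<and> z i \<le> t - \<delta>}) / real n - real N / real n) \<longlonglongrightarrow> M (t - \<delta>)"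
      using tendsto_diff[OF z lim] by simp
    then have "\<forall>\<^sub>F n in sequentially. A < real (card {i. i < n \<and> z i \<le> t - \<delta>}) / real n - real N / real n"
      using \<delta>(2) by (rule order_tendstoD)
    then show "\<forall>\<^sub>F n in sequentially. A < real (card {i. i < n \<and> x i \<le> t}) / real n"
    proof eventually_elim
      case (elim n)
      have "(real (card {i. i < n \<and> z i \<le> t - \<delta>}) - real N) / real n \<le> real (card {i. i < n \<and> x i \<le> t}) / real n"
        using N[of n] by (intro divide_right_mono) auto
      with elim show ?case by (simp add: diff_divide_distrib)
    qed
  next
    fix A assume "M t < A"
    with cont have "\<forall>\<^sub>F s in at t. M s < A" unfolding isCont_def by (rule order_tendstoD)
    then obtain d where d: "d > 0" "\<And>s. s \<noteq> t \<Longrightarrow> dist s t < d \<Longrightarrow> M s < A"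
      unfolding eventually_at by auto
    define \<delta> where "\<delta> = d / 2"
    have \<delta>: "\<delta> > 0" "M (t + \<delta>) < A" using d by (auto simp: \<delta>_def dist_real_def)
    obtain N where N: "\<And>n. real (card {i. i < n \<and> x i \<le> t}) \<le> real (card {i. i < n \<and> z i \<le> t + \<delta>}) + real N"
      using card_le[OF xz \<delta>(1), of t] by auto
    have "(\<lambda>n. real (card {i. i < n \<and> z i \<le> t + \<delta>}) / real n + real N / real n) \<longlonglongrightarrow> M (t + \<delta>)"
      using tendsto_add[OF z lim] by simp
    then have "\<forall>\<^sub>F n in sequentially. real (card {i. i < n \<and> z i \<le> t + \<delta>}) / real n + real N / real n < A"
      using \<delta>(2) by (rule order_tendstoD)
    then show "\<forall>\<^sub>F n in sequentially. real (card {i. i < n \<and> x i \<le> t}) / real n < A"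
    proof eventually_elim
      case (elim n)
      have "real (card {i. i < n \<and> x i \<le> t}) / real n \<le> (real (card {i. i < n \<and> z i \<le> t + \<delta>}) + real N) / real n"
        using N[of n] by (intro divide_right_mono) auto
      with elim show ?case by (simp add: add_divide_distrib)
    qed
  qed
qed

subsection \<open>Limit frequencies\<close>

lemma mono_level_threshold:
  fixes f :: "real \<Rightarrow> real"
  assumes "mono f"
  obtains c where "0 \<le> c" "c \<le> 1"
    "\<And>y. 0 \<le> y \<Longrightarrow> y \<le> 1 \<Longrightarrow> y < c \<Longrightarrow> f y \<le> t" "\<And>y. 0 \<le> y \<Longrightarrow> y \<le> 1 \<Longrightarrow> c < y \<Longrightarrow> t < f y"
proof
  \<comment> \<open>The threshold is the supremum of the sublevel set; inserting 0 covers the case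
    that this set is empty.\<close>
  let ?S = "insert 0 {y. 0 \<le> y \<and> y \<le> 1 \<and> f y \<le> t}"
  have bdd: "bdd_above ?S" by (rule bdd_aboveI[of _ 1]) auto
  show "0 \<le> Sup ?S" by (rule cSup_upper[OF _ bdd]) simp
  show "Sup ?S \<le> 1" by (rule cSup_least) auto
  fix y :: real assume y: "0 \<le> y" "y \<le> 1"
  {
    assume "y < Sup ?S"
    then obtain s where s: "s \<in> ?S" "y < s" using less_cSup_iff[OF _ bdd, of y] by blast
    then have "f s \<le> t" using y by auto
    moreover have "f y \<le> f s" using s by (intro monoD[OF assms]) simp
    ultimately show "f y \<le> t" by simp
  next
    assume less: "Sup ?S < y"
    show "t < f y"
    proof (rule ccontr)
      assume "\<not> t < f y"
      then have "y \<in> ?S" using y by simp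
      then have "y \<le> Sup ?S" by (rule cSup_upper[OF _ bdd])
      then show False using less by simp
    qed
  }
qed

lemma card_initial_segment:
  fixes P :: "nat \<Rightarrow> bool"
  assumes "\<And>i j. i \<le> j \<Longrightarrow> j < q \<Longrightarrow> P j \<Longrightarrow> P i" and "j < q"
  shows "P j \<longleftrightarrow> j < card {i. i < q \<and> P i}"
proof
  assume "P j"
  then have "{..j} \<subseteq> {i. i < q \<and> P i}" using assms by auto
  then have "card {..j} \<le> card {i. i < q \<and> P i}" by (intro card_mono) auto
  then show "j < card {i. i < q \<and> P i}" by simp
next
  assume less: "j < card {i. i < q \<and> P i}"
  show "P j"
  proof (rule ccontr)
    assume "\<not> P j"
    then have "{i. i < q \<and> P i} \<subseteq> {..<j}" using assms(1) by (auto simp: not_le[symmetric])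
    then have "card {i. i < q \<and> P i} \<le> card {..<j}" by (intro card_mono) auto
    then show False using less by simp
  qed
qed

section \<open>Irrational rotation number\<close>

context contracted_rotation
begin

lemma cdf_mu_irrational:
  assumes "rho \<notin> \<rat>"
  shows "cdf (mu a b) t = measure lborel {y \<in> {0..1}. phi a b rho y \<le> t}"
proof -
  have meas: "phi a b rho \<in> borel_measurable borel"
    by (rule borel_measurable_mono[OF mono_phi])
  then have m: "phi a b rho \<in> measurable (restrict_space lborel {0..1}) borel"
    by (intro measurable_restrict_space1) simp
  have "cdf (mu a b) t = measure (distr (restrict_space lborel {0..1}) borel (phi a b rho)) {..t}"
    using assms by (simp add: cdf_def mu_def rho_def Let_def)
  also have "\<dots> = measure (restrict_space lborel {0..1}) (phi a b rho -` {..t} \<inter> {0..1})"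
    using m by (subst measure_distr) (auto simp: space_restrict_space)
  also have "\<dots> = measure lborel (phi a b rho -` {..t} \<inter> {0..1})"
    by (rule measure_restrict_space) auto
  also have "phi a b rho -` {..t} \<inter> {0..1} = {y \<in> {0..1}. phi a b rho y \<le> t}" by auto
  finally show ?thesis .
qed

text \<open>The sublevel set of the monotone \<open>phi\<close> is an interval from 0 to some
  \<open>c\<close>, with or without its endpoint, so its Lebesgue measure is \<open>c\<close>. The
  rotation visits it with frequency \<open>c\<close>.\<close>

lemma frequency_phi_irrational:
  assumes "rho \<notin> \<rat>"
  shows "(\<lambda>n. real (card {i. i < n \<and> phi a b rho (frac (real i * rho + \<theta>)) \<le> t}) / real n)
           \<longlonglongrightarrow> cdf (mu a b) t"
proof -
  obtain c where c: "0 \<le> c" "c \<le> 1"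
    and le: "\<And>y. 0 \<le> y \<Longrightarrow> y \<le> 1 \<Longrightarrow> y < c \<Longrightarrow> phi a b rho y \<le> t"
    and gt: "\<And>y. 0 \<le> y \<Longrightarrow> y \<le> 1 \<Longrightarrow> c < y \<Longrightarrow> t < phi a b rho y"
    using mono_level_threshold[OF mono_phi] by metis
  let ?S = "{y \<in> {0..1}. phi a b rho y \<le> t}"
  have "phi a b rho -` {..t} \<inter> {0..1} \<in> sets borel"
    using measurable_sets[OF borel_measurable_mono[OF mono_phi[of rho]], of "{..t}"] by simp
  moreover have "phi a b rho -` {..t} \<inter> {0..1} = ?S" by auto
  ultimately have S: "?S \<in> sets borel" by simp
  have sub: "{0..<c} \<subseteq> ?S" "?S \<subseteq> {0..c}"
    using c le gt by (auto simp: not_less[symmetric])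
  have S_fin: "?S \<in> fmeasurable lborel"
    by (rule fmeasurableI2[OF fmeasurable_compact[OF compact_Icc] sub(2)]) (use S in simp)
  have "measure lborel {0..<c} \<le> measure lborel ?S"
    using sub(1) S_fin by (intro measure_mono_fmeasurable) auto
  moreover have "measure lborel ?S \<le> measure lborel {0..c}"
    using S by (intro measure_mono_fmeasurable[OF sub(2)] fmeasurable_compact compact_Icc) simp
  ultimately have cdf: "cdf (mu a b) t = c"
    unfolding cdf_mu_irrational[OF assms] using c by simp
  define A where "A n = {i. i < n \<and> frac (real i * rho + \<theta>) < c}" for n :: nat
  define B where "B n = {i. i < n \<and> phi a b rho (frac (real i * rho + \<theta>)) \<le> t}" for n :: nat
  define E where "E = {i :: nat. frac (real i * rho + \<theta>) = c}"
  \<comment> \<open>Two visits to the endpoint \<open>c\<close> would make \<open>rho\<close>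
    rational, so the undecided endpoint affects the count by at most 1.\<close>
  have E: "i = j" if "i \<in> E" "j \<in> E" for i j
  proof (rule ccontr)
    assume "i \<noteq> j"
    have "real i * rho - real j * rho = of_int (\<lfloor>real i * rho + \<theta>\<rfloor> - \<lfloor>real j * rho + \<theta>\<rfloor>)"
      using that by (simp add: E_def frac_def)
    then have "rho = of_int (\<lfloor>real i * rho + \<theta>\<rfloor> - \<lfloor>real j * rho + \<theta>\<rfloor>) / of_int (int i - int j)"
      using \<open>i \<noteq> j\<close> by (simp add: field_simps)
    then show False using assms by (metis Rats_divide Rats_of_int)
  qed
  have E_card: "finite E \<and> card E \<le> 1"
  proof (cases "E = {}")
    case False
    then obtain i where "i \<in> E" by blast
    then have "E = {i}" using E by blast
    then show ?thesis by simp
  qed simp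
  have AB: "A n \<subseteq> B n" for n
    using le[OF frac_ge_0 less_imp_le[OF frac_lt_1]] unfolding A_def B_def by auto
  have BA: "B n \<subseteq> A n \<union> E" for n
  proof
    fix i assume i: "i \<in> B n"
    then have "\<not> c < frac (real i * rho + \<theta>)"
      using gt[of "frac (real i * rho + \<theta>)"] frac_lt_1[of "real i * rho + \<theta>"]
      by (auto simp: B_def)
    then show "i \<in> A n \<union> E" using i by (auto simp: A_def B_def E_def)
  qed
  have fin: "finite (A n)" "finite (B n)" for n unfolding A_def B_def by auto
  have low: "real (card (A n)) / real n \<le> real (card (B n)) / real n" for n
    using card_mono[OF fin(2) AB] by (intro divide_right_mono) auto
  have up: "real (card (B n)) / real n \<le> real (card (A n)) / real n + 1 / real n" for n
  proof -
    have "card (B n) \<le> card (A n \<union> E)" using BA fin E_card by (intro card_mono) auto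
    also have "\<dots> \<le> card (A n) + 1" using card_Un_le[of "A n" E] E_card by linarith
    finally have "real (card (B n)) / real n \<le> (real (card (A n)) + 1) / real n"
      by (intro divide_right_mono) auto
    then show ?thesis by (simp add: add_divide_distrib)
  qed
  have lim: "(\<lambda>n. real (card (A n)) / real n) \<longlonglongrightarrow> c"
    unfolding A_def by (rule frequency_frac_less[OF equidistributed_length_irrational[OF assms] c])
  moreover have "(\<lambda>n. real (card (A n)) / real n + 1 / real n) \<longlonglongrightarrow> c"
    using tendsto_add[OF lim lim_const_over_n[of 1]] by simp
  ultimately show ?thesis
    unfolding cdf B_def[symmetric]
    by (rule tendsto_sandwich[rotated 2]) (use low up in auto)
qed

end

section \<open>Rational rotation number: the attracting cycle\<close>

locale rational_contracted_rotation = contracted_rotation +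
  fixes p :: int and q :: nat
  assumes cop: "coprime p (int q)" and q_pos: "q > 0" and rho_eq: "rho = of_int p / of_int (int q)"
begin

lemma floor_over_q: "\<lfloor>y - (real j + 1) * rho\<rfloor> = (\<lfloor>real q * y\<rfloor> - int (Suc j) * p) div int q"
proof -
  have "y - (real j + 1) * rho = (real q * y - of_int (int (Suc j) * p)) / of_int (int q)"
    using q_pos by (simp add: rho_eq field_simps)
  then have "\<lfloor>y - (real j + 1) * rho\<rfloor> = \<lfloor>real q * y - of_int (int (Suc j) * p)\<rfloor> div int q"
    by (simp only: floor_divide_real_eq_div of_nat_0_le_iff)
  then show ?thesis by (simp only: floor_diff_of_int)
qed

lemma phi_step: "phi a b rho y = phi a b rho (of_int \<lfloor>real q * y\<rfloor> / real q)"
  unfolding phi_def floor_over_q using q_pos by simp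

text \<open>Choosing \<open>m\<close> with \<open>m * p\<close> congruent to \<open>k\<close> modulo
  \<open>q\<close> makes \<open>k / q - m * rho\<close> an integer, so its floor drops strictly when
  \<open>k\<close> is replaced by \<open>j\<close>. One strict term among weakly ordered ones
  suffices.\<close>

lemma phi_strict:
  assumes "j < k"
  shows "phi a b rho (of_int j / real q) < phi a b rho (of_int k / real q)"
proof -
  let ?f = "\<lambda>l i. a ^ i * real_of_int \<lfloor>of_int l / real q - (real i + 1) * rho\<rfloor>"
  have fl: "\<lfloor>of_int l / real q - (real i + 1) * rho\<rfloor> = (l - int (Suc i) * p) div int q" for l i
    unfolding floor_over_q using q_pos by simp
  obtain m where m: "m > 0" "int q dvd int m * p - k"
    using coprime_multiple_cong[OF cop q_pos] by blast
  then have "int q dvd k - int m * p" by (metis dvd_minus_iff minus_diff_eq)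
  then obtain l where l: "k - int m * p = int q * l" by (auto elim: dvdE)
  have strict: "(j - int m * p) div int q < (k - int m * p) div int q"
  proof -
    have "(j - int m * p) div int q \<le> (int q * l - 1) div int q"
      using assms l q_pos by (intro zdiv_mono1) auto
    also have "int q * l - 1 = int q * (l - 1) + (int q - 1)" by (simp add: algebra_simps)
    also have "(int q * (l - 1) + (int q - 1)) div int q = l - 1"
      using q_pos by (simp only: div_mult_self4) (simp add: div_pos_pos_trivial)
    finally show ?thesis using l q_pos by simp
  qed
  have "0 < (\<Sum>i. ?f k i - ?f j i)"
  \<comment> \<open>The term with index \<open>i\<close> involves \<open>(i + 1) * rho\<close>,
    hence the shift by one.\<close>
  proof (rule suminf_pos2[where i = "m - 1"])
    show "summable (\<lambda>i. ?f k i - ?f j i)" by (intro summable_diff summable_phi)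
    show "0 \<le> ?f k i - ?f j i" for i
      using assms a_pos q_pos
      by (auto intro!: mult_left_mono floor_mono divide_right_mono diff_right_mono)
    have "?f j (m - 1) < ?f k (m - 1)"
      using strict m(1) a_pos unfolding fl by simp
    then show "0 < ?f k (m - 1) - ?f j (m - 1)" by simp
  qed
  also have "\<dots> = suminf (?f k) - suminf (?f j)"
    by (rule suminf_diff[OF summable_phi summable_phi, symmetric])
  finally show ?thesis using a_less by (simp add: phi_def)
qed

text \<open>By \<open>phi_step\<close>, \<open>phi\<close> is constant on each interval from
  \<open>j / q\<close> up to \<open>(j + 1) / q\<close>; for \<open>j < q\<close> these are its
  values on \<open>{0..<1}\<close>.\<close>

definition cycle_point :: "nat \<Rightarrow> real" where "cycle_point j = phi a b rho (real j / real q)"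

lemma cycle_less: "j < k \<Longrightarrow> cycle_point j < cycle_point k"
  using phi_strict[of "int j" "int k"] by (simp add: cycle_point_def)

lemma inj_cycle: "inj cycle_point"
  by (rule strict_mono_imp_inj_on) (auto simp: strict_mono_def cycle_less)

definition cycle_index :: "real \<Rightarrow> nat \<Rightarrow> nat" where
  "cycle_index \<theta> n = nat \<lfloor>real q * frac (real n * rho + \<theta>)\<rfloor>"

lemma cycle_index_less: "cycle_index \<theta> n < q"
proof -
  have "real q * frac (real n * rho + \<theta>) < real q * 1"
    using q_pos frac_lt_1 by (intro mult_strict_left_mono) auto
  then show ?thesis using q_pos by (simp add: cycle_index_def nat_less_iff floor_less_iff)
qed

lemma cycle_index_less_iff:
  "cycle_index \<theta> n < J \<longleftrightarrow> frac (real n * rho + \<theta>) < real J / real q"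
proof -
  have "0 \<le> \<lfloor>real q * frac (real n * rho + \<theta>)\<rfloor>" by simp
  then have "cycle_index \<theta> n < J \<longleftrightarrow> real q * frac (real n * rho + \<theta>) < real J"
    by (auto simp: cycle_index_def nat_less_iff floor_less_iff)
  also have "\<dots> \<longleftrightarrow> frac (real n * rho + \<theta>) < real J / real q"
    using q_pos by (simp add: field_simps)
  finally show ?thesis .
qed

lemma phi_frac_eq_cycle: "phi a b rho (frac (real n * rho + \<theta>)) = cycle_point (cycle_index \<theta> n)"
proof -
  have "0 \<le> \<lfloor>real q * frac (real n * rho + \<theta>)\<rfloor>" by simp
  then show ?thesis
    by (subst phi_step) (simp add: cycle_point_def cycle_index_def)
qed

lemma frac_add_q: "frac (real (n + q * k) * rho + \<theta>) = frac (real n * rho + \<theta>)"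
proof -
  have "real (n + q * k) * rho + \<theta> = (real n * rho + \<theta>) + of_int (int k * p)"
    using q_pos by (simp add: rho_eq field_simps)
  then show ?thesis by (simp only: frac_add_of_int_right)
qed

text \<open>Multiplied by \<open>q\<close>, the rotation acts on floors as translation by
  \<open>p\<close> modulo \<open>q\<close>, which reaches every residue class by
  coprimality.\<close>

lemma cycle_index_surj:
  assumes "j < q"
  shows "\<exists>n. cycle_index \<theta> n = j"
proof -
  define T where "T = \<lfloor>real q * \<theta>\<rfloor>"
  obtain m where "int q dvd int m * p - (int j - T)"
    using coprime_multiple_cong[OF cop q_pos] by blast
  then obtain l where "int m * p - (int j - T) = int q * l" by (rule dvdE)
  then have l: "int m * p + T = int q * l + int j" by simp
  have "real q * (real m * rho + \<theta>) = real q * \<theta> + of_int (int m * p)"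
    using q_pos by (simp add: rho_eq field_simps)
  then have "\<lfloor>real q * (real m * rho + \<theta>)\<rfloor> = T + int m * p"
    by (simp only: floor_add_int[symmetric] T_def)
  then have fq: "\<lfloor>real q * (real m * rho + \<theta>)\<rfloor> = int q * l + int j"
    using l by simp
  have "\<lfloor>real m * rho + \<theta>\<rfloor> = \<lfloor>real q * (real m * rho + \<theta>) / of_int (int q)\<rfloor>"
    using q_pos by simp
  also have "\<dots> = \<lfloor>real q * (real m * rho + \<theta>)\<rfloor> div int q"
    by (rule floor_divide_real_eq_div) simp
  also have "\<dots> = l" unfolding fq using assms by simp
  finally have "real q * frac (real m * rho + \<theta>) = real q * (real m * rho + \<theta>) - of_int (int q * l)"
    by (simp add: frac_def algebra_simps)
  then have "\<lfloor>real q * frac (real m * rho + \<theta>)\<rfloor> = int j"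
    using fq by (simp only: floor_diff_of_int)
  then show ?thesis unfolding cycle_index_def by (intro exI[of _ m]) simp
qed

lemma range_cycle_index: "range (\<lambda>n. cycle_point (cycle_index \<theta> n)) = cycle_point ` {..<q}"
proof -
  have "range (cycle_index \<theta>) = {..<q}"
  proof
    show "range (cycle_index \<theta>) \<subseteq> {..<q}" using cycle_index_less by auto
    show "{..<q} \<subseteq> range (cycle_index \<theta>)"
    proof
      fix j assume "j \<in> {..<q}"
      then obtain n where "cycle_index \<theta> n = j" using cycle_index_surj by auto
      then show "j \<in> range (cycle_index \<theta>)" by auto
    qed
  qed
  then show ?thesis by (metis image_image)
qed

lemma orbit_asymptotic_cycle:
  assumes "is_orbit a b x"
  obtains \<theta> where "(\<lambda>n. x n - cycle_point (cycle_index \<theta> n)) \<longlonglongrightarrow> 0"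
  using orbit_asymptotic[OF assms] unfolding phi_frac_eq_cycle by blast

text \<open>The orbit and its asymptotic cycle have the common period \<open>q * Q\<close>. Along
  multiples of it their difference is constant and tends to 0, so it vanishes.\<close>

lemma periodic_orbit_range:
  assumes "is_periodic_orbit a b x"
  shows "range x = cycle_point ` {..<q}"
proof -
  obtain Q where Q: "Q \<ge> 1" "\<And>n. x (n + Q) = x n"
    using assms by (auto simp: is_periodic_orbit_def)
  obtain \<theta> where \<theta>: "(\<lambda>n. x n - cycle_point (cycle_index \<theta> n)) \<longlonglongrightarrow> 0"
    using assms orbit_asymptotic_cycle by (auto simp: is_periodic_orbit_def)
  have "x n = cycle_point (cycle_index \<theta> n)" for n
  proof -
    have "x (n + k * Q) = x n" for k
      by (induction k) (auto simp: Q(2) add.assoc[symmetric] add.commute[of Q])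
    moreover have "cycle_index \<theta> (n + q * k) = cycle_index \<theta> n" for k
      unfolding cycle_index_def frac_add_q ..
    ultimately have const: "x (n + q * k * Q) - cycle_point (cycle_index \<theta> (n + q * k * Q))
        = x n - cycle_point (cycle_index \<theta> n)" for k
      by (metis mult.assoc)
    have "filterlim (\<lambda>k. n + q * k * Q) sequentially sequentially"
      using Q q_pos by (intro filterlim_subseq strict_monoI) auto
    from filterlim_compose[OF \<theta> this] have "(\<lambda>k. x n - cycle_point (cycle_index \<theta> n)) \<longlonglongrightarrow> 0"
      unfolding const .
    then show ?thesis by (simp add: LIMSEQ_const_iff)
  qed
  then show ?thesis using range_cycle_index[of \<theta>] by simp
qed

text \<open>The periodic orbit is the limit of the given one along residue classes modulo
  \<open>q\<close>. The limits stay in \<open>{0..1}\<close>, and the functional equation of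
  \<open>phi\<close> provides the integrality for \<open>is_orbitI\<close>.\<close>

lemma periodic_orbit_exists:
  assumes "is_orbit a b x"
  shows "\<exists>z. is_periodic_orbit a b z"
proof -
  obtain \<theta> where \<theta>: "(\<lambda>n. x n - phi a b rho (frac (real n * rho + \<theta>))) \<longlonglongrightarrow> 0"
    using orbit_asymptotic[OF assms] by blast
  define z where "z n = phi a b rho (frac (real n * rho + \<theta>))" for n
  have per: "z (n + q * k) = z n" for n k
    unfolding z_def frac_add_q ..
  have lim: "(\<lambda>k. x (n + q * k)) \<longlonglongrightarrow> z n" for n
  proof -
    have "filterlim (\<lambda>k. n + q * k) sequentially sequentially"
      using q_pos by (intro filterlim_subseq strict_monoI) auto
    with \<theta> have "(\<lambda>k. x (n + q * k) - z (n + q * k)) \<longlonglongrightarrow> 0"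
      unfolding z_def by (rule filterlim_compose)
    then show ?thesis unfolding per by (simp add: LIM_zero_iff)
  qed
  have "is_orbit a b z"
  proof (rule is_orbitI)
    show "0 \<le> z n" for n
      using assms by (intro LIMSEQ_le_const[OF lim]) (auto simp: is_orbit_def)
    show "z n \<le> 1" for n
      using assms by (intro LIMSEQ_le_const2[OF lim]) (auto simp: is_orbit_def)
    show "a * z n + b - z (Suc n) \<in> \<int>" for n
    proof -
      have "real (Suc n) * rho + \<theta> = (real n * rho + \<theta>) + rho" by (simp add: algebra_simps)
      then have "a * z n + b - z (Suc n)
          = of_int (\<lfloor>real (Suc n) * rho + \<theta>\<rfloor> - \<lfloor>real n * rho + \<theta>\<rfloor>)"
        unfolding z_def phi_frac by (simp only: phi_add_rotation) (simp add: algebra_simps)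
      then show ?thesis by (metis Ints_of_int)
    qed
  qed
  moreover have "\<exists>Q\<ge>1. \<forall>n. z (n + Q) = z n"
    using per[of _ 1] q_pos by (intro exI[of _ q]) auto
  ultimately show ?thesis unfolding is_periodic_orbit_def by blast
qed

text \<open>Existence and uniqueness of the range of a periodic orbit resolve the definite
  description.\<close>

lemma periodic_set_eq:
  assumes "is_orbit a b x"
  shows "periodic_set a b = cycle_point ` {..<q}"
  unfolding periodic_set_def
proof (rule the_equality)
  show "\<exists>z. is_periodic_orbit a b z \<and> cycle_point ` {..<q} = range z"
    using periodic_orbit_exists[OF assms] periodic_orbit_range by metis
qed (use periodic_orbit_range in blast)

lemma cdf_mu_rational:
  assumes "is_orbit a b x"
  shows "cdf (mu a b) t = real (card {j. j < q \<and> cycle_point j \<le> t}) / real q"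
proof -
  let ?C = "cycle_point ` {..<q}"
  have "rho \<in> \<rat>" unfolding rho_eq by (intro Rats_divide Rats_of_int)
  then have "cdf (mu a b) t = measure (distr (uniform_count_measure ?C) borel (\<lambda>x. x)) {..t}"
    using periodic_set_eq[OF assms] by (simp add: cdf_def mu_def rho_def Let_def)
  also have "\<dots> = measure (uniform_count_measure ?C) ({..t} \<inter> ?C)"
    by (subst measure_distr)
       (auto simp: measurable_def sets_uniform_count_measure space_uniform_count_measure)
  also have "\<dots> = card ({..t} \<inter> ?C) / card ?C"
    by (rule measure_uniform_count_measure) auto
  also have "{..t} \<inter> ?C = cycle_point ` {j. j < q \<and> cycle_point j \<le> t}" by auto
  finally show ?thesis
    using inj_cycle by (simp add: card_image inj_on_subset)
qed

text \<open>The cycle points increase with their index, so those at most \<open>t\<close> are the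
  first \<open>J\<close>. Visiting them means that the rotation lies below \<open>J / q\<close>, an
  equidistributed length.\<close>

lemma frequency_cycle:
  assumes "is_orbit a b x"
  shows "(\<lambda>n. real (card {i. i < n \<and> cycle_point (cycle_index \<theta> i) \<le> t}) / real n) \<longlonglongrightarrow> cdf (mu a b) t"
proof -
  define J where "J = card {j. j < q \<and> cycle_point j \<le> t}"
  have "J \<le> card {..<q}" unfolding J_def by (intro card_mono) auto
  then have "J \<le> q" by simp
  have "cycle_point j \<le> t \<longleftrightarrow> j < J" if "j < q" for j
    unfolding J_def
  proof (rule card_initial_segment[OF _ that])
    show "cycle_point i \<le> t" if "i \<le> k" "cycle_point k \<le> t" for i k
      using that cycle_less[of i k] by (cases "i = k") auto
  qed
  then have "{i. i < n \<and> cycle_point (cycle_index \<theta> i) \<le> t}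
      = {i. i < n \<and> frac (real i * rho + \<theta>) < real J / real q}" for n
    using cycle_index_less by (auto simp: cycle_index_less_iff)
  moreover have "(\<lambda>n. real (card {i. i < n \<and> frac (real i * rho + \<theta>) < real J / real q}) / real n)
      \<longlonglongrightarrow> real J / real q"
    using equidistributed_length_rational[OF cop q_pos rho_eq, of "int J"] \<open>J \<le> q\<close> q_pos
    by (intro frequency_frac_less) auto
  ultimately show ?thesis
    unfolding cdf_mu_rational[OF assms] J_def[symmetric] by simp
qed

end

section \<open>Frequencies and weak convergence for every rotation number\<close>

context contracted_rotation
begin

lemma orbit_frequency_limit:
  assumes "is_orbit a b x"
  obtains \<theta> where "(\<lambda>n. x n - phi a b rho (frac (real n * rho + \<theta>))) \<longlonglongrightarrow> 0"
    "\<And>t. (\<lambda>n. real (card {i. i < n \<and> phi a b rho (frac (real i * rho + \<theta>)) \<le> t}) / real n)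
       \<longlonglongrightarrow> cdf (mu a b) t"
proof -
  obtain \<theta> where \<theta>: "(\<lambda>n. x n - phi a b rho (frac (real n * rho + \<theta>))) \<longlonglongrightarrow> 0"
    using orbit_asymptotic[OF assms] by blast
  have "(\<lambda>n. real (card {i. i < n \<and> phi a b rho (frac (real i * rho + \<theta>)) \<le> t}) / real n)
      \<longlonglongrightarrow> cdf (mu a b) t" for t
  proof (cases "rho \<in> \<rat>")
    case True
    then obtain p r where r: "r > 0" "coprime p r" "rho = of_int p / of_int r"
      by (metis Rats_cases')
    then interpret rational_contracted_rotation a b p "nat r"
      by unfold_locales auto
    show ?thesis unfolding phi_frac_eq_cycle by (rule frequency_cycle[OF assms])
  qed (rule frequency_phi_irrational)
  with \<theta> show thesis by (rule that)
qed

end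

theorem theorem10p1:
  fixes a b :: real and x :: "nat \<Rightarrow> real"
  assumes "0 < a" and "a < 1" and "0 \<le> b" and "b < 1"
    and "is_orbit a b x"
  shows "weak_conv_m (empirical_measure x) (mu a b)"
proof -
  interpret contracted_rotation a b
    using assms by unfold_locales
  obtain \<theta> where x: "(\<lambda>n. x n - phi a b rho (frac (real n * rho + \<theta>))) \<longlonglongrightarrow> 0"
    and freq: "\<And>t. (\<lambda>n. real (card {i. i < n \<and> phi a b rho (frac (real i * rho + \<theta>)) \<le> t}) / real n)
       \<longlonglongrightarrow> cdf (mu a b) t"
    using orbit_frequency_limit[OF assms(5)] by blast
  show ?thesis
    unfolding weak_conv_m_def weak_conv_def
  proof (intro allI impI)
    \<comment> \<open>Weak convergence is tested at continuity points of the limit distribution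
      function, where frequencies pass from the \<open>phi\<close> sequence to the orbit.\<close>
    fix t assume "isCont (cdf (mu a b)) t"
    with x freq have "(\<lambda>n. real (card {i. i < n \<and> x i \<le> t}) / real n) \<longlonglongrightarrow> cdf (mu a b) t"
      by (rule frequency_perturbation)
    moreover have "\<forall>\<^sub>F n in sequentially.
        real (card {i. i < n \<and> x i \<le> t}) / real n = cdf (empirical_measure x n) t"
      by (intro eventually_sequentiallyI[of 1]) (simp add: cdf_empirical_measure)
    ultimately show "(\<lambda>n. cdf (empirical_measure x n) t) \<longlonglongrightarrow> cdf (mu a b) t"
      by (rule Lim_transform_eventually)
  qed
qed

end
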